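(* Let $(\mathfrak{g},[\cdot,\cdot],\delta_\mathfrak{g})$ be a Lie bialgebra over $k$, $E$ a vector space containing $\mathfrak{g}$ as a subspace, and $V$ a complement of $\mathfrak{g}$ in $E$. Suppose that there is a Lie bialgebra structure $(E,[\cdot,\cdot],\delta_E)$ on $E$ such that $(\mathfrak{g},[\cdot,\cdot],\delta_\mathfrak{g})$ is a Lie sub-bialgebra of $E$. Then there exists a Lie bialgebraic extending structure $\Omega^{bi}(\mathfrak{g},V)=(\lhd,\rhd,f,\{\cdot,\cdot\},\Delta_E,\Delta_V,\delta_V)$ of $(\mathfrak{g},[\cdot,\cdot],\delta_\mathfrak{g})$ by $V$ such that $(E,[\cdot,\cdot],\delta_E)\cong\mathfrak{g}\natural^{bi}V$ as Lie bialgebras.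
   Context: $k$ is a field of characteristic $0$; all vector spaces and (multi)linear maps are over $k$. $I$ denotes the identity map. A Lie coalgebra $(\mathfrak{g},\delta_\mathfrak{g})$ is a vector space with a linear map $\delta_\mathfrak{g}:\mathfrak{g}\to\mathfrak{g}\otimes\mathfrak{g}$ such that $\delta_\mathfrak{g}=-\tau\delta_\mathfrak{g}$ and $(I\otimes\delta_\mathfrak{g})\delta_\mathfrak{g}-\tau_{12}(I\otimes\delta_\mathfrak{g})\delta_\mathfrak{g}=(\delta_\mathfrak{g}\otimes I)\delta_\mathfrak{g}$, where $\tau(a\otimes b)=b\otimes a$, $\tau_{12}(a\otimes b\otimes c)=b\otimes a\otimes c$. A Lie bialgebra $(\mathfrak{g},[\cdot,\cdot],\delta_\mathfrak{g})$ is a Lie algebra that is also a Lie coalgebra, with $\delta_\mathfrak{g}([a,b])=a.\delta_\mathfrak{g}(b)-b.\delta_\mathfrak{g}(a)$ for all $a,b$, where $a.(b\otimes c)=[a,b]\otimes c+b\otimes[a,c]$. Homomorphisms of Lie bialgebras are linear maps that are both Lie algebra and Lie coalgebra homomorphisms ($\delta\varphi=(\varphi\otimes\varphi)\delta$). A Lie sub-bialgebra is a subspace $\mathfrak{g}\subseteq E$ with a Lie bialgebra structure such that the bracket and co-bracket of $E$ restrict to those of $\mathfrak{g}$. An extending datum of $(\mathfrak{g},[\cdot,\cdot],\delta_\mathfrak{g})$ by $V$ is a system $\Omega^{bi}(\mathfrak{g},V)=(\lhd,\rhd,f,\{\cdot,\cdot\},\Delta_E,\Delta_V,\delta_V)$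 of bilinear maps $\lhd:V\times\mathfrak{g}\to V$, $\rhd:V\times\mathfrak{g}\to\mathfrak{g}$, $f:V\times V\to\mathfrak{g}$, $\{\cdot,\cdot\}:V\times V\to V$ and linear maps $\Delta_E:V\to\mathfrak{g}\otimes V$, $\Delta_V:V\to\mathfrak{g}\otimes\mathfrak{g}$, $\delta_V:V\to V\otimes V$. Given such a datum, $\mathfrak{g}\natural^{bi}V$ denotes the vector space $\mathfrak{g}\oplus V$ with $[a+x,b+y]=[a,b]+x\rhd b-y\rhd a+f(x,y)+x\lhd b-y\lhd a+\{x,y\}$ and $\delta(a+x)=\delta_\mathfrak{g}(a)+\Delta_E(x)-\tau\Delta_E(x)+\Delta_V(x)+\delta_V(x)$ for $a,b\in\mathfrak{g}$, $x,y\in V$. If this is a Lie bialgebra, $\mathfrak{g}\natural^{bi}V$ is called the unified bi-product and the datum is called a Lie bialgebraic extending structure of $(\mathfrak{g},[\cdot,\cdot],\delta_\mathfrak{g})$ by $V$. *)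

theory Defs
  imports
    "HOL-Analysis.Product_Vector"
    "HOL-Library.Poly_Mapping"
    "HOL-Library.Set_Algebras"
begin

text \<open>
  A vector space is given by a scalar multiplication making a type into a \<^term>\<open>vector_space\<close>,
  together with a subspace of that type as its carrier; maps only matter on carriers.
\<close>

definition linear_on ::
  "('k \<Rightarrow> 'a::ab_group_add \<Rightarrow> 'a) \<Rightarrow> 'a set \<Rightarrow> ('k \<Rightarrow> 'b::ab_group_add \<Rightarrow> 'b) \<Rightarrow> 'b set \<Rightarrow>
    ('a \<Rightarrow> 'b) \<Rightarrow> bool"
  where "linear_on sA A sB B h \<longleftrightarrow>
    (\<forall>x\<in>A. h x \<in> B) \<and>
    (\<forall>x\<in>A. \<forall>y\<in>A. h (x + y) = h x + h y) \<and>
    (\<forall>c. \<forall>x\<in>A. h (sA c x) = sB c (h x))"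

definition bilinear_on ::
  "('k \<Rightarrow> 'a::ab_group_add \<Rightarrow> 'a) \<Rightarrow> 'a set \<Rightarrow> ('k \<Rightarrow> 'b::ab_group_add \<Rightarrow> 'b) \<Rightarrow> 'b set \<Rightarrow>
    ('k \<Rightarrow> 'c::ab_group_add \<Rightarrow> 'c) \<Rightarrow> 'c set \<Rightarrow> ('a \<Rightarrow> 'b \<Rightarrow> 'c) \<Rightarrow> bool"
  where "bilinear_on sA A sB B sC C h \<longleftrightarrow>
    (\<forall>a\<in>A. linear_on sB B sC C (\<lambda>b. h a b)) \<and>
    (\<forall>b\<in>B. linear_on sA A sC C (\<lambda>a. h a b))"

section \<open>Tensor products\<close>

text \<open>
  The type \<^typ>\<open>'x \<Rightarrow>\<^sub>0 'k\<close> is the free vector space on \<^typ>\<open>'x\<close>. The tensor product of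
  \<open>A\<close> and \<open>B\<close> is the quotient of the free vector space on \<open>A \<times> B\<close> by the subspace \<open>N\<close> spanned by
  the bilinearity relations, and its elements are the cosets \<open>p +o N\<close>. Consequently the sum of two
  tensors \<open>X\<close>, \<open>Y\<close> is the Minkowski sum \<open>X + Y\<close>, the negative of \<open>X\<close> is \<open>uminus ` X\<close> (neither
  \<open>- X\<close> nor \<open>X - Y\<close>, which are set complement and set difference), and a linear map \<open>F\<close> of free
  vector spaces compatible with the relations induces \<open>X \<mapsto> F ` X + N'\<close> on the quotients.
\<close>

definition free_scale :: "'k::field \<Rightarrow> ('x \<Rightarrow>\<^sub>0 'k) \<Rightarrow> ('x \<Rightarrow>\<^sub>0 'k)"
  where "free_scale c = Poly_Mapping.map ((*) c)"

definition free_gen :: "'x \<Rightarrow> ('x \<Rightarrow>\<^sub>0 'k::field)"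
  where "free_gen x = Poly_Mapping.single x 1"

definition free_extend :: "('x \<Rightarrow> ('y \<Rightarrow>\<^sub>0 'k)) \<Rightarrow> ('x \<Rightarrow>\<^sub>0 'k::field) \<Rightarrow> ('y \<Rightarrow>\<^sub>0 'k)"
  where "free_extend h p =
    (\<Sum>x\<in>Poly_Mapping.keys p. free_scale (Poly_Mapping.lookup p x) (h x))"

text \<open>The relations expressing that \<^term>\<open>\<lambda>a. free_gen (slot a)\<close> is linear on \<open>A\<close>.\<close>

definition slot_relations ::
  "('k::field \<Rightarrow> 'a::ab_group_add \<Rightarrow> 'a) \<Rightarrow> 'a set \<Rightarrow> ('a \<Rightarrow> 'x) \<Rightarrow> ('x \<Rightarrow>\<^sub>0 'k) set"
  where "slot_relations s A slot =
    {free_gen (slot (a + a')) - free_gen (slot a) - free_gen (slot a') | a a'. a \<in> A \<and> a' \<in> A} \<union>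
    {free_gen (slot (s c a)) - free_scale c (free_gen (slot a)) | c a. a \<in> A}"

definition tensor_null ::
  "('k::field \<Rightarrow> 'a::ab_group_add \<Rightarrow> 'a) \<Rightarrow> 'a set \<Rightarrow> ('k \<Rightarrow> 'b::ab_group_add \<Rightarrow> 'b) \<Rightarrow> 'b set \<Rightarrow>
    ('a \<times> 'b \<Rightarrow>\<^sub>0 'k) set"
  where "tensor_null sA A sB B = module.span free_scale
    ((\<Union>b\<in>B. slot_relations sA A (\<lambda>a. (a, b))) \<union> (\<Union>a\<in>A. slot_relations sB B (\<lambda>b. (a, b))))"

definition tensor_product ::
  "('k::field \<Rightarrow> 'a::ab_group_add \<Rightarrow> 'a) \<Rightarrow> 'a set \<Rightarrow> ('k \<Rightarrow> 'b::ab_group_add \<Rightarrow> 'b) \<Rightarrow> 'b set \<Rightarrow>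
    ('a \<times> 'b \<Rightarrow>\<^sub>0 'k) set set"
  where "tensor_product sA A sB B =
    {p +o tensor_null sA A sB B | p. Poly_Mapping.keys p \<subseteq> A \<times> B}"

definition tensor_scale ::
  "('k::field \<Rightarrow> 'a::ab_group_add \<Rightarrow> 'a) \<Rightarrow> 'a set \<Rightarrow> ('k \<Rightarrow> 'b::ab_group_add \<Rightarrow> 'b) \<Rightarrow> 'b set \<Rightarrow>
    'k \<Rightarrow> ('a \<times> 'b \<Rightarrow>\<^sub>0 'k) set \<Rightarrow> ('a \<times> 'b \<Rightarrow>\<^sub>0 'k) set"
  where "tensor_scale sA A sB B c X = free_scale c ` X + tensor_null sA A sB B"

text \<open>\<open>g \<otimes> h\<close>, with values in the tensor product of \<open>C\<close> and \<open>D\<close>.\<close>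

definition tensor_map ::
  "('k::field \<Rightarrow> 'c::ab_group_add \<Rightarrow> 'c) \<Rightarrow> 'c set \<Rightarrow> ('k \<Rightarrow> 'd::ab_group_add \<Rightarrow> 'd) \<Rightarrow> 'd set \<Rightarrow>
    ('a \<Rightarrow> 'c) \<Rightarrow> ('b \<Rightarrow> 'd) \<Rightarrow> ('a \<times> 'b \<Rightarrow>\<^sub>0 'k) set \<Rightarrow> ('c \<times> 'd \<Rightarrow>\<^sub>0 'k) set"
  where "tensor_map sC C sD D g h X =
    free_extend (\<lambda>(a, b). free_gen (g a, h b)) ` X + tensor_null sC C sD D"

text \<open>The flip \<open>\<tau>\<close> from the tensor product of \<open>A\<close> and \<open>B\<close> to that of \<open>B\<close> and \<open>A\<close>.\<close>

definition tensor_swap ::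
  "('k::field \<Rightarrow> 'a::ab_group_add \<Rightarrow> 'a) \<Rightarrow> 'a set \<Rightarrow> ('k \<Rightarrow> 'b::ab_group_add \<Rightarrow> 'b) \<Rightarrow> 'b set \<Rightarrow>
    ('a \<times> 'b \<Rightarrow>\<^sub>0 'k) set \<Rightarrow> ('b \<times> 'a \<Rightarrow>\<^sub>0 'k) set"
  where "tensor_swap sA A sB B X =
    free_extend (\<lambda>(a, b). free_gen (b, a)) ` X + tensor_null sB B sA A"

text \<open>Linearity of a map from \<open>D\<close> to the tensor product of \<open>A\<close> and \<open>B\<close>.\<close>

definition tensor_linear_on ::
  "('k::field \<Rightarrow> 'd::ab_group_add \<Rightarrow> 'd) \<Rightarrow> 'd set \<Rightarrow> ('k \<Rightarrow> 'a::ab_group_add \<Rightarrow> 'a) \<Rightarrow> 'a set \<Rightarrow>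
    ('k \<Rightarrow> 'b::ab_group_add \<Rightarrow> 'b) \<Rightarrow> 'b set \<Rightarrow> ('d \<Rightarrow> ('a \<times> 'b \<Rightarrow>\<^sub>0 'k) set) \<Rightarrow> bool"
  where "tensor_linear_on sD D sA A sB B \<delta> \<longleftrightarrow>
    (\<forall>x\<in>D. \<delta> x \<in> tensor_product sA A sB B) \<and>
    (\<forall>x\<in>D. \<forall>y\<in>D. \<delta> (x + y) = \<delta> x + \<delta> y) \<and>
    (\<forall>c. \<forall>x\<in>D. \<delta> (sD c x) = tensor_scale sA A sB B c (\<delta> x))"

text \<open>The same construction for the triple tensor product of \<open>A\<close> with itself, in which
  \<open>A \<otimes> (A \<otimes> A)\<close> and \<open>(A \<otimes> A) \<otimes> A\<close> are identified.\<close>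

definition tensor3_null ::
  "('k::field \<Rightarrow> 'a::ab_group_add \<Rightarrow> 'a) \<Rightarrow> 'a set \<Rightarrow> ('a \<times> 'a \<times> 'a \<Rightarrow>\<^sub>0 'k) set"
  where "tensor3_null s A = module.span free_scale
    (\<Union>b\<in>A. \<Union>c\<in>A. slot_relations s A (\<lambda>a. (a, b, c)) \<union>
      slot_relations s A (\<lambda>a. (b, a, c)) \<union> slot_relations s A (\<lambda>a. (b, c, a)))"

definition tensor3_swap12 ::
  "('k::field \<Rightarrow> 'a::ab_group_add \<Rightarrow> 'a) \<Rightarrow> 'a set \<Rightarrow>
    ('a \<times> 'a \<times> 'a \<Rightarrow>\<^sub>0 'k) set \<Rightarrow> ('a \<times> 'a \<times> 'a \<Rightarrow>\<^sub>0 'k) set"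
  where "tensor3_swap12 s A X =
    free_extend (\<lambda>(a, b, c). free_gen (b, a, c)) ` X + tensor3_null s A"

text \<open>\<open>I \<otimes> \<delta>\<close> and \<open>\<delta> \<otimes> I\<close>; the representative of the coset \<open>\<delta> b\<close> chosen by \<open>SOME\<close>
  is irrelevant modulo the relations.\<close>

definition tensor_id_left ::
  "('k::field \<Rightarrow> 'a::ab_group_add \<Rightarrow> 'a) \<Rightarrow> 'a set \<Rightarrow> ('a \<Rightarrow> ('a \<times> 'a \<Rightarrow>\<^sub>0 'k) set) \<Rightarrow>
    ('a \<times> 'a \<Rightarrow>\<^sub>0 'k) set \<Rightarrow> ('a \<times> 'a \<times> 'a \<Rightarrow>\<^sub>0 'k) set"
  where "tensor_id_left s A \<delta> X =
    free_extend (\<lambda>(a, b). free_extend (\<lambda>(c, d). free_gen (a, c, d)) (SOME q. q \<in> \<delta> b)) ` X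
      + tensor3_null s A"

definition tensor_id_right ::
  "('k::field \<Rightarrow> 'a::ab_group_add \<Rightarrow> 'a) \<Rightarrow> 'a set \<Rightarrow> ('a \<Rightarrow> ('a \<times> 'a \<Rightarrow>\<^sub>0 'k) set) \<Rightarrow>
    ('a \<times> 'a \<Rightarrow>\<^sub>0 'k) set \<Rightarrow> ('a \<times> 'a \<times> 'a \<Rightarrow>\<^sub>0 'k) set"
  where "tensor_id_right s A \<delta> X =
    free_extend (\<lambda>(a, b). free_extend (\<lambda>(c, d). free_gen (c, d, b)) (SOME q. q \<in> \<delta> a)) ` X
      + tensor3_null s A"

section \<open>Lie bialgebras\<close>

locale lie_algebra = vector_space s
  for s :: "'k::field \<Rightarrow> 'a::ab_group_add \<Rightarrow> 'a" +
  fixes L :: "'a set" and br :: "'a \<Rightarrow> 'a \<Rightarrow> 'a"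
  assumes subspace_carrier: "subspace L"
    and bracket_bilinear: "bilinear_on s L s L s L br"
    and bracket_alternating: "x \<in> L \<Longrightarrow> br x x = 0"
    and jacobi: "x \<in> L \<Longrightarrow> y \<in> L \<Longrightarrow> z \<in> L \<Longrightarrow>
      br x (br y z) + br y (br z x) + br z (br x y) = 0"

locale lie_coalgebra = vector_space s
  for s :: "'k::field \<Rightarrow> 'a::ab_group_add \<Rightarrow> 'a" +
  fixes L :: "'a set" and \<delta> :: "'a \<Rightarrow> ('a \<times> 'a \<Rightarrow>\<^sub>0 'k) set"
  assumes subspace_cocarrier: "subspace L"
    and cobracket_linear: "tensor_linear_on s L s L s L \<delta>"
    and cobracket_skew: "x \<in> L \<Longrightarrow> \<delta> x = uminus ` tensor_swap s L s L (\<delta> x)"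
    and cojacobi: "x \<in> L \<Longrightarrow>
      tensor_id_left s L \<delta> (\<delta> x) + uminus ` tensor3_swap12 s L (tensor_id_left s L \<delta> (\<delta> x))
        = tensor_id_right s L \<delta> (\<delta> x)"

text \<open>The action \<open>a.(b \<otimes> c) = [a,b] \<otimes> c + b \<otimes> [a,c]\<close>.\<close>

definition tensor_act ::
  "('k::field \<Rightarrow> 'a::ab_group_add \<Rightarrow> 'a) \<Rightarrow> 'a set \<Rightarrow> ('a \<Rightarrow> 'a \<Rightarrow> 'a) \<Rightarrow>
    'a \<Rightarrow> ('a \<times> 'a \<Rightarrow>\<^sub>0 'k) set \<Rightarrow> ('a \<times> 'a \<Rightarrow>\<^sub>0 'k) set"
  where "tensor_act s L br a X =
    tensor_map s L s L (br a) (\<lambda>c. c) X + tensor_map s L s L (\<lambda>b. b) (br a) X"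

locale lie_bialgebra = lie_algebra s L br + lie_coalgebra s L \<delta>
  for s :: "'k::field \<Rightarrow> 'a::ab_group_add \<Rightarrow> 'a" and L br \<delta> +
  assumes cocycle: "a \<in> L \<Longrightarrow> b \<in> L \<Longrightarrow>
      \<delta> (br a b) = tensor_act s L br a (\<delta> b) + uminus ` tensor_act s L br b (\<delta> a)"

definition lie_bialgebra_hom ::
  "('k::field \<Rightarrow> 'a::ab_group_add \<Rightarrow> 'a) \<Rightarrow> 'a set \<Rightarrow> ('a \<Rightarrow> 'a \<Rightarrow> 'a) \<Rightarrow>
      ('a \<Rightarrow> ('a \<times> 'a \<Rightarrow>\<^sub>0 'k) set) \<Rightarrow>
    ('k \<Rightarrow> 'b::ab_group_add \<Rightarrow> 'b) \<Rightarrow> 'b set \<Rightarrow> ('b \<Rightarrow> 'b \<Rightarrow> 'b) \<Rightarrow>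
      ('b \<Rightarrow> ('b \<times> 'b \<Rightarrow>\<^sub>0 'k) set) \<Rightarrow> ('a \<Rightarrow> 'b) \<Rightarrow> bool"
  where "lie_bialgebra_hom s L br \<delta> s' L' br' \<delta>' \<phi> \<longleftrightarrow>
    linear_on s L s' L' \<phi> \<and>
    (\<forall>x\<in>L. \<forall>y\<in>L. \<phi> (br x y) = br' (\<phi> x) (\<phi> y)) \<and>
    (\<forall>x\<in>L. \<delta>' (\<phi> x) = tensor_map s' L' s' L' \<phi> \<phi> (\<delta> x))"

definition lie_bialgebra_isomorphic ::
  "('k::field \<Rightarrow> 'a::ab_group_add \<Rightarrow> 'a) \<Rightarrow> 'a set \<Rightarrow> ('a \<Rightarrow> 'a \<Rightarrow> 'a) \<Rightarrow>
      ('a \<Rightarrow> ('a \<times> 'a \<Rightarrow>\<^sub>0 'k) set) \<Rightarrow>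
    ('k \<Rightarrow> 'b::ab_group_add \<Rightarrow> 'b) \<Rightarrow> 'b set \<Rightarrow> ('b \<Rightarrow> 'b \<Rightarrow> 'b) \<Rightarrow>
      ('b \<Rightarrow> ('b \<times> 'b \<Rightarrow>\<^sub>0 'k) set) \<Rightarrow> bool"
  where "lie_bialgebra_isomorphic s L br \<delta> s' L' br' \<delta>' \<longleftrightarrow>
    (\<exists>\<phi>. lie_bialgebra_hom s L br \<delta> s' L' br' \<delta>' \<phi> \<and> bij_betw \<phi> L L')"

text \<open>The last condition compares cobrackets along the map
  \<open>G \<otimes> G \<rightarrow> E \<otimes> E\<close> induced by the inclusion.\<close>

definition lie_sub_bialgebra ::
  "('k::field \<Rightarrow> 'a::ab_group_add \<Rightarrow> 'a) \<Rightarrow> 'a set \<Rightarrow> ('a \<Rightarrow> 'a \<Rightarrow> 'a) \<Rightarrow>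
      ('a \<Rightarrow> ('a \<times> 'a \<Rightarrow>\<^sub>0 'k) set) \<Rightarrow>
    'a set \<Rightarrow> ('a \<Rightarrow> 'a \<Rightarrow> 'a) \<Rightarrow> ('a \<Rightarrow> ('a \<times> 'a \<Rightarrow>\<^sub>0 'k) set) \<Rightarrow> bool"
  where "lie_sub_bialgebra s G brG \<delta>G E brE \<delta>E \<longleftrightarrow>
    lie_bialgebra s G brG \<delta>G \<and> lie_bialgebra s E brE \<delta>E \<and> G \<subseteq> E \<and>
    (\<forall>a\<in>G. \<forall>b\<in>G. brE a b = brG a b) \<and>
    (\<forall>a\<in>G. \<delta>E a = tensor_map s E s E (\<lambda>x. x) (\<lambda>x. x) (\<delta>G a))"

section \<open>Extending data and the unified bi-product\<close>

text \<open>The fields are, in this order, the maps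
  \<open>\<lhd>, \<rhd>, f, {\<cdot>,\<cdot>}, \<Delta>\<^sub>E, \<Delta>\<^sub>V, \<delta>\<^sub>V\<close>.\<close>

record (overloaded) ('k, 'g, 'v) extending_datum =
  ltri :: "'v \<Rightarrow> 'g \<Rightarrow> 'v"
  rtri :: "'v \<Rightarrow> 'g \<Rightarrow> 'g"
  cocyc :: "'v \<Rightarrow> 'v \<Rightarrow> 'g"
  vbr :: "'v \<Rightarrow> 'v \<Rightarrow> 'v"
  DeltaE :: "'v \<Rightarrow> ('g \<times> 'v \<Rightarrow>\<^sub>0 'k) set"
  DeltaV :: "'v \<Rightarrow> ('g \<times> 'g \<Rightarrow>\<^sub>0 'k) set"
  deltaV :: "'v \<Rightarrow> ('v \<times> 'v \<Rightarrow>\<^sub>0 'k) set"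

definition is_extending_datum ::
  "('k::field \<Rightarrow> 'g::ab_group_add \<Rightarrow> 'g) \<Rightarrow> 'g set \<Rightarrow> ('k \<Rightarrow> 'v::ab_group_add \<Rightarrow> 'v) \<Rightarrow> 'v set \<Rightarrow>
    ('k, 'g, 'v) extending_datum \<Rightarrow> bool"
  where "is_extending_datum sG G sV V \<Omega> \<longleftrightarrow>
    bilinear_on sV V sG G sV V (ltri \<Omega>) \<and>
    bilinear_on sV V sG G sG G (rtri \<Omega>) \<and>
    bilinear_on sV V sV V sG G (cocyc \<Omega>) \<and>
    bilinear_on sV V sV V sV V (vbr \<Omega>) \<and>
    tensor_linear_on sV V sG G sV V (DeltaE \<Omega>) \<and>
    tensor_linear_on sV V sG G sG G (DeltaV \<Omega>) \<and>
    tensor_linear_on sV V sV V sV V (deltaV \<Omega>)"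

definition unified_bracket ::
  "('g::ab_group_add \<Rightarrow> 'g \<Rightarrow> 'g) \<Rightarrow> ('k, 'g, 'v::ab_group_add) extending_datum \<Rightarrow>
    'g \<times> 'v \<Rightarrow> 'g \<times> 'v \<Rightarrow> 'g \<times> 'v"
  where "unified_bracket br \<Omega> = (\<lambda>(a, x) (b, y).
    (br a b + rtri \<Omega> x b - rtri \<Omega> y a + cocyc \<Omega> x y,
     ltri \<Omega> x b - ltri \<Omega> y a + vbr \<Omega> x y))"

definition unified_cobracket ::
  "('k::field \<Rightarrow> 'g::ab_group_add \<Rightarrow> 'g) \<Rightarrow> 'g set \<Rightarrow> ('g \<Rightarrow> ('g \<times> 'g \<Rightarrow>\<^sub>0 'k) set) \<Rightarrow>
    ('k \<Rightarrow> 'v::ab_group_add \<Rightarrow> 'v) \<Rightarrow> 'v set \<Rightarrow> ('k, 'g, 'v) extending_datum \<Rightarrow>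
    'g \<times> 'v \<Rightarrow> (('g \<times> 'v) \<times> ('g \<times> 'v) \<Rightarrow>\<^sub>0 'k) set"
  where "unified_cobracket sG G \<delta> sV V \<Omega> = (\<lambda>(a, x).
    let s = module_prod.scale sG sV; P = G \<times> V; iG = (\<lambda>a. (a, 0)); iV = (\<lambda>x. (0, x)) in
      tensor_map s P s P iG iG (\<delta> a)
      + tensor_map s P s P iG iV (DeltaE \<Omega> x)
      + uminus ` tensor_map s P s P iV iG (tensor_swap sG G sV V (DeltaE \<Omega> x))
      + tensor_map s P s P iG iG (DeltaV \<Omega> x)
      + tensor_map s P s P iV iV (deltaV \<Omega> x))"

definition lie_bialgebraic_extending_structure ::
  "('k::field \<Rightarrow> 'g::ab_group_add \<Rightarrow> 'g) \<Rightarrow> 'g set \<Rightarrow> ('g \<Rightarrow> 'g \<Rightarrow> 'g) \<Rightarrow>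
      ('g \<Rightarrow> ('g \<times> 'g \<Rightarrow>\<^sub>0 'k) set) \<Rightarrow>
    ('k \<Rightarrow> 'v::ab_group_add \<Rightarrow> 'v) \<Rightarrow> 'v set \<Rightarrow> ('k, 'g, 'v) extending_datum \<Rightarrow> bool"
  where "lie_bialgebraic_extending_structure sG G br \<delta> sV V \<Omega> \<longleftrightarrow>
    is_extending_datum sG G sV V \<Omega> \<and>
    lie_bialgebra (module_prod.scale sG sV) (G \<times> V)
      (unified_bracket br \<Omega>) (unified_cobracket sG G \<delta> sV V \<Omega>)"

end

theory Submission
  imports Defs
begin

text \<open>
  Let \<open>\<pi>\<^sub>G\<close>, \<open>\<pi>\<^sub>V\<close> be the projections of \<open>E = G \<oplus> V\<close>. The extending datum consists of the components
  of the structure of \<open>E\<close> on \<open>V\<close>: \<open>x \<lhd> b = \<pi>\<^sub>V[x,b]\<close>, \<open>x \<rhd> b = \<pi>\<^sub>G[x,b]\<close>, \<open>f(x,y) = \<pi>\<^sub>G[x,y]\<close>,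
  \<open>{x,y} = \<pi>\<^sub>V[x,y]\<close>, \<open>\<Delta>\<^sub>E = (\<pi>\<^sub>G \<otimes> \<pi>\<^sub>V)\<delta>\<^sub>E\<close>, \<open>\<Delta>\<^sub>V = (\<pi>\<^sub>G \<otimes> \<pi>\<^sub>G)\<delta>\<^sub>E\<close>, \<open>\<delta>\<^sub>V = (\<pi>\<^sub>V \<otimes> \<pi>\<^sub>V)\<delta>\<^sub>E\<close>. Since the
  bracket and cobracket of \<open>E\<close> are skew, the unified bracket and cobracket are exactly those of \<open>E\<close>
  carried along the linear bijection \<open>x \<mapsto> (\<pi>\<^sub>G x, \<pi>\<^sub>V x)\<close>, and the Lie bialgebra axioms are carried
  along with them.
\<close>

section \<open>Maps out of free vector spaces\<close>

lemma lookup_free_scale [simp]: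
  "Poly_Mapping.lookup (free_scale c p) x = c * Poly_Mapping.lookup p x"
  unfolding free_scale_def by transfer (simp add: when_def)

interpretation free: module free_scale
  by unfold_locales (auto intro!: poly_mapping_eqI simp: lookup_add algebra_simps)

text \<open>The extra terms have coefficient 0. Cancellation can shrink the support of
  \<open>p + q\<close>, so linearity of \<open>free_extend h\<close> is checked over one finite
  index set that contains all supports involved.\<close>

lemma free_extend_superset:
  assumes "finite S" "Poly_Mapping.keys p \<subseteq> S"
  shows "free_extend h p = (\<Sum>x\<in>S. free_scale (Poly_Mapping.lookup p x) (h x))"
  unfolding free_extend_def
  using assms by (intro sum.mono_neutral_left) (auto simp: in_keys_iff)

lemma free_extend_hom:
  fixes h :: "'a \<Rightarrow> ('c \<Rightarrow>\<^sub>0 'b::field)"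
  shows "module_hom free_scale free_scale (free_extend h)"
proof unfold_locales
  fix p q :: "'a \<Rightarrow>\<^sub>0 'b" and c :: 'b
  let ?S = "Poly_Mapping.keys p \<union> Poly_Mapping.keys q"
  have S: "finite ?S" by simp
  have sub: "Poly_Mapping.keys (p + q) \<subseteq> ?S" by (rule keys_add)
  have sub': "Poly_Mapping.keys (free_scale c p) \<subseteq> ?S" by (auto simp: in_keys_iff)
  show "free_extend h (p + q) = free_extend h p + free_extend h q"
    using sub by (simp add: free_extend_superset[OF S] lookup_add free.scale_left_distrib sum.distrib)
  show "free_extend h (free_scale c p) = free_scale c (free_extend h p)"
    using sub' by (simp add: free_extend_superset[OF S] free.scale_sum_right)
qed

lemmas free_extend_add = module_hom.add[OF free_extend_hom]
  and free_extend_scale = module_hom.scale[OF free_extend_hom]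
  and free_extend_diff = module_hom.diff[OF free_extend_hom]
  and free_extend_neg = module_hom.neg[OF free_extend_hom]
  and free_extend_sum = module_hom.sum[OF free_extend_hom]

lemma keys_free_gen [simp]: "Poly_Mapping.keys (free_gen x :: 'x \<Rightarrow>\<^sub>0 'k::field) = {x}"
  by (simp add: free_gen_def)

lemma free_extend_gen [simp]: "free_extend h (free_gen x) = h x"
  by (simp add: free_extend_def) (simp add: free_gen_def)

text \<open>Linearity moves \<open>free_extend g\<close> inside the finite sum. Composites of
  induced maps can therefore be compared on generators alone.\<close>

lemma free_extend_comp:
  "free_extend g (free_extend h p) = free_extend (\<lambda>x. free_extend g (h x)) p"
proof -
  have "free_extend g (free_extend h p) =
      (\<Sum>x\<in>Poly_Mapping.keys p. free_scale (Poly_Mapping.lookup p x) (free_extend g (h x)))"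
    unfolding free_extend_def[of h p] by (simp only: free_extend_sum free_extend_scale)
  then show ?thesis by (simp only: free_extend_def[of _ p])
qed

text \<open>The difference is a linear combination of the elements \<open>g x - h x\<close>, all in
  the subspace \<open>N\<close>. The support condition is there because bilinearity relations are
  available only for entries in the carriers.\<close>

lemma free_extend_cong_mod:
  assumes "free.subspace N" "\<And>x. x \<in> K \<Longrightarrow> g x - h x \<in> N" "Poly_Mapping.keys p \<subseteq> K"
  shows "free_extend g p - free_extend h p \<in> N"
proof -
  have "free_extend g p - free_extend h p =
      (\<Sum>x\<in>Poly_Mapping.keys p. free_scale (Poly_Mapping.lookup p x) (g x - h x))"
    by (simp add: free_extend_def sum_subtractf free.scale_right_diff_distrib)
  also have "\<dots> \<in> N"
    using assms by (intro free.subspace_sum free.subspace_scale) auto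
  finally show ?thesis .
qed

lemma free_extend_cong:
  assumes "\<And>x. x \<in> Poly_Mapping.keys p \<Longrightarrow> g x = h x"
  shows "free_extend g p = free_extend h p"
  using assms by (simp add: free_extend_def)

lemma free_extend_fun_add: "free_extend (\<lambda>x. g x + h x) p = free_extend g p + free_extend h p"
  by (simp add: free_extend_def free.scale_right_distrib sum.distrib)

lemma free_extend_fun_scale: "free_extend (\<lambda>x. free_scale c (g x)) p = free_scale c (free_extend g p)"
  by (simp add: free_extend_def free.scale_sum_right mult.commute)

text \<open>Phrased as a subspace so that support bounds become closure properties, both for the
  sums defining \<open>free_extend\<close> and for the span \<open>tensor_null\<close>.\<close>

lemma subspace_keys: "free.subspace {p :: 'x \<Rightarrow>\<^sub>0 'k::field. Poly_Mapping.keys p \<subseteq> K}"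
proof (rule free.subspaceI)
  fix p q :: "'x \<Rightarrow>\<^sub>0 'k" and c :: 'k
  assume p: "p \<in> {p. Poly_Mapping.keys p \<subseteq> K}"
  have "Poly_Mapping.keys (free_scale c p) \<subseteq> Poly_Mapping.keys p"
    by (auto simp: in_keys_iff)
  with p show "free_scale c p \<in> {p. Poly_Mapping.keys p \<subseteq> K}" by blast
  assume "q \<in> {p. Poly_Mapping.keys p \<subseteq> K}"
  with p keys_add[of p q] show "p + q \<in> {p. Poly_Mapping.keys p \<subseteq> K}" by blast
qed simp

lemma keys_free_extend:
  assumes "\<And>x. x \<in> K \<Longrightarrow> Poly_Mapping.keys (h x) \<subseteq> K'" "Poly_Mapping.keys p \<subseteq> K"
  shows "Poly_Mapping.keys (free_extend h p) \<subseteq> K'"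
proof -
  have "free_extend h p \<in> {q. Poly_Mapping.keys q \<subseteq> K'}"
    unfolding free_extend_def
    by (rule free.subspace_sum[OF subspace_keys], rule free.subspace_scale[OF subspace_keys])
      (use assms in blast)
  then show ?thesis by simp
qed

text \<open>The preimage of \<open>N\<close> under a linear map is a subspace, so it contains the
  span of \<open>R\<close> once it contains \<open>R\<close>. Well-definedness on a quotient thus
  reduces to the generating relations.\<close>

lemma free_extend_span:
  assumes "free.subspace N" "\<And>r. r \<in> R \<Longrightarrow> free_extend h r \<in> N" "n \<in> free.span R"
  shows "free_extend h n \<in> N"
proof -
  have "free.span R \<subseteq> {x. free_extend h x \<in> N}"
    by (rule free.span_minimal)
      (use assms(2) module_hom.subspace_linear_preimage[OF free_extend_hom assms(1)] in auto)
  with assms(3) show ?thesis by blast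
qed

section \<open>Cosets\<close>

lemma coset_self: "free.subspace N \<Longrightarrow> p \<in> p +o N"
  using free.subspace_0 by (force simp: elt_set_plus_def)

lemma in_coset_iff: "q \<in> p +o N \<longleftrightarrow> q - p \<in> (N :: ('x \<Rightarrow>\<^sub>0 'k::field) set)"
  by (force simp: elt_set_plus_def algebra_simps)

lemma coset_eq_iff:
  assumes N: "free.subspace N"
  shows "p +o N = q +o N \<longleftrightarrow> p - q \<in> N"
proof
  assume d: "p - q \<in> N"
  have "r - p \<in> N \<longleftrightarrow> r - q \<in> N" for r
  proof
    assume "r - p \<in> N"
    from free.subspace_add[OF N this d] show "r - q \<in> N" by simp
  next
    assume "r - q \<in> N"
    from free.subspace_diff[OF N this d] show "r - p \<in> N" by simp
  qed
  then show "p +o N = q +o N" by (simp add: set_eq_iff in_coset_iff)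
next
  assume "p +o N = q +o N"
  with coset_self[OF N, of p] show "p - q \<in> N" by (simp add: in_coset_iff)
qed

lemma coset_of_mem: "free.subspace N \<Longrightarrow> q \<in> p +o N \<Longrightarrow> q +o N = p +o N"
  by (simp add: coset_eq_iff in_coset_iff)

lemma set_plus_self:
  assumes N: "free.subspace N"
  shows "N + N = N"
proof
  show "N + N \<subseteq> N"
    using free.subspace_add[OF N] by (blast elim: set_plus_elim)
  show "N \<subseteq> N + N"
    using set_zero_plus2[OF free.subspace_0[OF N]] .
qed

lemma coset_add: "free.subspace N \<Longrightarrow> (p +o N) + (q +o N) = (p + q) +o N"
  by (simp add: set_plus_rearrange set_plus_self)

lemma coset_neg:
  assumes N: "free.subspace N"
  shows "uminus ` (p +o N) = (- p) +o N"
proof (rule set_eqI)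
  fix q
  have "q \<in> uminus ` (p +o N) \<longleftrightarrow> - q \<in> p +o N"
    by (metis add.inverse_inverse image_iff)
  also have "\<dots> \<longleftrightarrow> - (q - (- p)) \<in> N"
    unfolding in_coset_iff by (simp only: minus_diff_eq minus_add_distrib diff_conv_add_uminus add.inverse_inverse add.commute)
  also have "\<dots> \<longleftrightarrow> q - (- p) \<in> N"
    by (metis N free.subspace_neg add.inverse_inverse)
  finally show "q \<in> uminus ` (p +o N) \<longleftrightarrow> q \<in> (- p) +o N" by (simp only: in_coset_iff)
qed

text \<open>A linear map need not send \<open>N\<close> onto \<open>N'\<close>, so the image of a
  coset may be only part of a coset; adding \<open>N'\<close> fills it up. One inclusion uses that
  \<open>F\<close> maps \<open>N\<close> into \<open>N'\<close>, the other uses the representative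
  \<open>p\<close> itself.\<close>

lemma coset_image:
  assumes N': "free.subspace N'" and N: "free.subspace N"
    and F: "module_hom free_scale free_scale F" and "\<And>n. n \<in> N \<Longrightarrow> F n \<in> N'"
  shows "F ` (p +o N) + N' = F p +o N'"
proof (intro set_eqI iffI)
  fix r assume "r \<in> F ` (p +o N) + N'"
  then obtain n n' where "n \<in> N" "n' \<in> N'" "r = F (p + n) + n'"
    by (auto simp: elt_set_plus_def set_plus_def)
  then show "r \<in> F p +o N'"
    using assms(4) free.subspace_add[OF N'] by (simp add: in_coset_iff module_hom.add[OF F])
next
  fix r assume "r \<in> F p +o N'"
  then obtain n' where "n' \<in> N'" "r = F p + n'"
    by (auto simp: elt_set_plus_def)
  then show "r \<in> F ` (p +o N) + N'"
    using coset_self[OF N, of p] by (blast intro: set_plus_intro)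
qed

lemmas coset_free_extend = coset_image[OF _ _ free_extend_hom]

section \<open>Tensor products\<close>

lemma linear_on_comp:
  "linear_on sA A sB B g \<Longrightarrow> linear_on sB B sC C h \<Longrightarrow> linear_on sA A sC C (\<lambda>x. h (g x))"
  by (simp add: linear_on_def)

lemma linear_on_id: "linear_on s A s A (\<lambda>x. x)"
  by (simp add: linear_on_def)

lemma linear_on_subset: "linear_on sA A sB B h \<Longrightarrow> A' \<subseteq> A \<Longrightarrow> linear_on sA A' sB B h"
  by (simp add: linear_on_def subset_iff)

lemma linear_on_add:
  assumes "vector_space sB" "module.subspace sB B"
    and "linear_on sA A sB B g" "linear_on sA A sB B h"
  shows "linear_on sA A sB B (\<lambda>x. g x + h x)"
proof -
  interpret vector_space sB by fact
  show ?thesis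
    using assms(2-) by (auto simp: linear_on_def subspace_add scale_right_distrib)
qed

lemma subspace_tensor_null [simp]: "free.subspace (tensor_null sA A sB B)"
  by (simp add: tensor_null_def)

lemma subspace_tensor3_null [simp]: "free.subspace (tensor3_null s A)"
  by (simp add: tensor3_null_def)

section \<open>Multilinearity relations and maps that respect them\<close>

lemma slot_relations_add:
  "a \<in> A \<Longrightarrow> a' \<in> A \<Longrightarrow>
    free_gen (slot (a + a')) - free_gen (slot a) - free_gen (slot a') \<in> slot_relations s A slot"
  unfolding slot_relations_def by blast

lemma slot_relations_scale:
  "a \<in> A \<Longrightarrow> free_gen (slot (s c a)) - free_scale c (free_gen (slot a)) \<in> slot_relations s A slot"
  unfolding slot_relations_def by blast

lemma tensor_null_relations:
  shows "\<lbrakk>a \<in> A; a' \<in> A; b \<in> B\<rbrakk> \<Longrightarrow>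
      free_gen (a + a', b) - free_gen (a, b) - free_gen (a', b) \<in> tensor_null sA A sB B"
    and "\<lbrakk>a \<in> A; b \<in> B\<rbrakk> \<Longrightarrow>
      free_gen (sA c a, b) - free_scale c (free_gen (a, b)) \<in> tensor_null sA A sB B"
    and "\<lbrakk>a \<in> A; b \<in> B; b' \<in> B\<rbrakk> \<Longrightarrow>
      free_gen (a, b + b') - free_gen (a, b) - free_gen (a, b') \<in> tensor_null sA A sB B"
    and "\<lbrakk>a \<in> A; b \<in> B\<rbrakk> \<Longrightarrow>
      free_gen (a, sB c b) - free_scale c (free_gen (a, b)) \<in> tensor_null sA A sB B"
  unfolding tensor_null_def
  subgoal by (rule free.span_base, rule UnI1, rule UN_I, assumption, rule slot_relations_add)
  subgoal by (rule free.span_base, rule UnI1, rule UN_I, assumption, rule slot_relations_scale)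
  subgoal by (rule free.span_base, rule UnI2, rule UN_I, assumption, rule slot_relations_add)
  subgoal by (rule free.span_base, rule UnI2, rule UN_I, assumption, rule slot_relations_scale)
  done

lemma tensor3_null_relations:
  assumes "x \<in> A" "y \<in> A"
  shows "\<lbrakk>a \<in> A; a' \<in> A\<rbrakk> \<Longrightarrow>
      free_gen (a + a', x, y) - free_gen (a, x, y) - free_gen (a', x, y) \<in> tensor3_null s A"
    and "a \<in> A \<Longrightarrow> free_gen (s c a, x, y) - free_scale c (free_gen (a, x, y)) \<in> tensor3_null s A"
    and "\<lbrakk>a \<in> A; a' \<in> A\<rbrakk> \<Longrightarrow>
      free_gen (x, a + a', y) - free_gen (x, a, y) - free_gen (x, a', y) \<in> tensor3_null s A"
    and "a \<in> A \<Longrightarrow> free_gen (x, s c a, y) - free_scale c (free_gen (x, a, y)) \<in> tensor3_null s A"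
    and "\<lbrakk>a \<in> A; a' \<in> A\<rbrakk> \<Longrightarrow>
      free_gen (x, y, a + a') - free_gen (x, y, a) - free_gen (x, y, a') \<in> tensor3_null s A"
    and "a \<in> A \<Longrightarrow> free_gen (x, y, s c a) - free_scale c (free_gen (x, y, a)) \<in> tensor3_null s A"
proof -
  let ?R = "\<lambda>x y. slot_relations s A (\<lambda>a. (a, x, y)) \<union> slot_relations s A (\<lambda>a. (x, a, y)) \<union>
    slot_relations s A (\<lambda>a. (x, y, a))"
  have R: "r \<in> tensor3_null s A" if "r \<in> ?R x y" for r
    unfolding tensor3_null_def using assms that
    by (intro free.span_base) (rule UN_I, assumption, rule UN_I)
  note slots = slot_relations_add[of _ A _ "\<lambda>a. (a, x, y)" s] slot_relations_scale[of _ A "\<lambda>a. (a, x, y)" s]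
    slot_relations_add[of _ A _ "\<lambda>a. (x, a, y)" s] slot_relations_scale[of _ A "\<lambda>a. (x, a, y)" s]
    slot_relations_add[of _ A _ "\<lambda>a. (x, y, a)" s] slot_relations_scale[of _ A "\<lambda>a. (x, y, a)" s]
  show "\<lbrakk>a \<in> A; a' \<in> A\<rbrakk> \<Longrightarrow>
      free_gen (a + a', x, y) - free_gen (a, x, y) - free_gen (a', x, y) \<in> tensor3_null s A"
    and "a \<in> A \<Longrightarrow> free_gen (s c a, x, y) - free_scale c (free_gen (a, x, y)) \<in> tensor3_null s A"
    and "\<lbrakk>a \<in> A; a' \<in> A\<rbrakk> \<Longrightarrow>
      free_gen (x, a + a', y) - free_gen (x, a, y) - free_gen (x, a', y) \<in> tensor3_null s A"
    and "a \<in> A \<Longrightarrow> free_gen (x, s c a, y) - free_scale c (free_gen (x, a, y)) \<in> tensor3_null s A"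
    and "\<lbrakk>a \<in> A; a' \<in> A\<rbrakk> \<Longrightarrow>
      free_gen (x, y, a + a') - free_gen (x, y, a) - free_gen (x, y, a') \<in> tensor3_null s A"
    and "a \<in> A \<Longrightarrow> free_gen (x, y, s c a) - free_scale c (free_gen (x, y, a)) \<in> tensor3_null s A"
    by (rule R; simp add: slots)+
qed

text \<open>The universal property of the tensor product, relative to a subspace \<open>N\<close>:
  each generating relation is sent into \<open>N\<close>. Asking for bilinearity only modulo
  \<open>N\<close> admits maps \<open>h\<close> built from arbitrarily chosen representatives of
  cobrackets.\<close>

lemma free_extend_tensor_null:
  assumes "free.subspace N"
    and "\<And>a a' b. \<lbrakk>a \<in> A; a' \<in> A; b \<in> B\<rbrakk> \<Longrightarrow> h (a + a', b) - h (a, b) - h (a', b) \<in> N"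
    and "\<And>c a b. \<lbrakk>a \<in> A; b \<in> B\<rbrakk> \<Longrightarrow> h (sA c a, b) - free_scale c (h (a, b)) \<in> N"
    and "\<And>a b b'. \<lbrakk>a \<in> A; b \<in> B; b' \<in> B\<rbrakk> \<Longrightarrow> h (a, b + b') - h (a, b) - h (a, b') \<in> N"
    and "\<And>c a b. \<lbrakk>a \<in> A; b \<in> B\<rbrakk> \<Longrightarrow> h (a, sB c b) - free_scale c (h (a, b)) \<in> N"
    and "n \<in> tensor_null sA A sB B"
  shows "free_extend h n \<in> N"
  using assms(6) unfolding tensor_null_def
  by (rule free_extend_span[OF assms(1), rotated])
    (auto simp: slot_relations_def free_extend_diff free_extend_scale intro: assms(2-5))

lemma free_extend_tensor3_null:
  assumes "free.subspace N"
    and "\<And>a a' x y. \<lbrakk>a \<in> A; a' \<in> A; x \<in> A; y \<in> A\<rbrakk> \<Longrightarrow> h (a + a', x, y) - h (a, x, y) - h (a', x, y) \<in> N"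
    and "\<And>c a x y. \<lbrakk>a \<in> A; x \<in> A; y \<in> A\<rbrakk> \<Longrightarrow> h (s c a, x, y) - free_scale c (h (a, x, y)) \<in> N"
    and "\<And>a a' x y. \<lbrakk>a \<in> A; a' \<in> A; x \<in> A; y \<in> A\<rbrakk> \<Longrightarrow> h (x, a + a', y) - h (x, a, y) - h (x, a', y) \<in> N"
    and "\<And>c a x y. \<lbrakk>a \<in> A; x \<in> A; y \<in> A\<rbrakk> \<Longrightarrow> h (x, s c a, y) - free_scale c (h (x, a, y)) \<in> N"
    and "\<And>a a' x y. \<lbrakk>a \<in> A; a' \<in> A; x \<in> A; y \<in> A\<rbrakk> \<Longrightarrow> h (x, y, a + a') - h (x, y, a) - h (x, y, a') \<in> N"
    and "\<And>c a x y. \<lbrakk>a \<in> A; x \<in> A; y \<in> A\<rbrakk> \<Longrightarrow> h (x, y, s c a) - free_scale c (h (x, y, a)) \<in> N"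
    and "n \<in> tensor3_null s A"
  shows "free_extend h n \<in> N"
  using assms(8) unfolding tensor3_null_def
  by (rule free_extend_span[OF assms(1), rotated])
    (auto simp: slot_relations_def free_extend_diff free_extend_scale intro: assms(2-7))

text \<open>Closure of \<open>L\<close> under addition and scaling keeps all entries of the
  generating relations in \<open>L\<close>. Consequently every representative of a tensor over
  \<open>L\<close> is supported on \<open>L \<times> L\<close>, not just a well-chosen one.\<close>

lemma keys_tensor_null:
  assumes "vector_space s" "module.subspace s L" "n \<in> tensor_null s L s L"
  shows "Poly_Mapping.keys n \<subseteq> L \<times> L"
proof -
  interpret vector_space s by fact
  define K :: "('b \<times> 'b \<Rightarrow>\<^sub>0 'a) set" where "K = {p. Poly_Mapping.keys p \<subseteq> L \<times> L}"
  have K: "free.subspace K" unfolding K_def by (rule subspace_keys)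
  have gen: "free_gen (x, y) \<in> K" if "x \<in> L" "y \<in> L" for x y
    using that by (simp add: K_def)
  have "tensor_null s L s L \<subseteq> K"
    unfolding tensor_null_def slot_relations_def
    by (rule free.span_minimal[OF _ K])
      (auto intro!: free.subspace_diff[OF K] free.subspace_scale[OF K] gen
        subspace_add[OF assms(2)] subspace_scale[OF assms(2)])
  with assms(3) show ?thesis by (auto simp: K_def)
qed

section \<open>Induced maps computed on representatives\<close>

lemma tensor_productE:
  assumes "X \<in> tensor_product sA A sB B"
  obtains p where "Poly_Mapping.keys p \<subseteq> A \<times> B" "X = p +o tensor_null sA A sB B"
  using assms by (auto simp: tensor_product_def)

lemma tensor_productI:
  "Poly_Mapping.keys p \<subseteq> A \<times> B \<Longrightarrow> p +o tensor_null sA A sB B \<in> tensor_product sA A sB B"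
  by (auto simp: tensor_product_def)

lemma tensor_scale_coset:
  "tensor_scale sA A sB B c (p +o tensor_null sA A sB B) = free_scale c p +o tensor_null sA A sB B"
  unfolding tensor_scale_def
  by (rule coset_image)
    (auto intro: free.module_hom_scale_self free.subspace_scale[OF subspace_tensor_null])

text \<open>Linear maps turn each bilinearity relation into one of the same kind, so
  \<open>g \<otimes> h\<close> may be evaluated on any representative. The laws of
  \<open>tensor_map\<close> below reduce to identities of \<open>free_extend\<close> in this
  way.\<close>

lemma tensor_map_coset:
  assumes "linear_on sA A sC C g" "linear_on sB B sD D h"
  shows "tensor_map sC C sD D g h (p +o tensor_null sA A sB B) =
    free_extend (\<lambda>(a, b). free_gen (g a, h b)) p +o tensor_null sC C sD D"
  unfolding tensor_map_def
proof (rule coset_free_extend[OF subspace_tensor_null subspace_tensor_null])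
  fix n assume n: "n \<in> tensor_null sA A sB B"
  show "free_extend (\<lambda>(a, b). free_gen (g a, h b)) n \<in> tensor_null sC C sD D"
    by (rule free_extend_tensor_null[OF subspace_tensor_null _ _ _ _ n])
      (use assms in \<open>auto simp: linear_on_def intro: tensor_null_relations\<close>)
qed

lemma tensor_swap_coset:
  "tensor_swap sA A sB B (p +o tensor_null sA A sB B) =
    free_extend (\<lambda>(a, b). free_gen (b, a)) p +o tensor_null sB B sA A"
  unfolding tensor_swap_def
proof (rule coset_free_extend[OF subspace_tensor_null subspace_tensor_null])
  fix n assume n: "n \<in> tensor_null sA A sB B"
  show "free_extend (\<lambda>(a, b). free_gen (b, a)) n \<in> tensor_null sB B sA A"
    by (rule free_extend_tensor_null[OF subspace_tensor_null _ _ _ _ n]) (auto intro: tensor_null_relations)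
qed

lemma tensor_product_add:
  assumes "X \<in> tensor_product sA A sB B" "Y \<in> tensor_product sA A sB B"
  shows "X + Y \<in> tensor_product sA A sB B"
proof -
  obtain p where "Poly_Mapping.keys p \<subseteq> A \<times> B" "X = p +o tensor_null sA A sB B"
    using assms(1) by (rule tensor_productE)
  moreover obtain q where "Poly_Mapping.keys q \<subseteq> A \<times> B" "Y = q +o tensor_null sA A sB B"
    using assms(2) by (rule tensor_productE)
  ultimately
  show ?thesis
    using keys_add[of p q] by (auto simp: coset_add intro!: tensor_productI)
qed

lemma tensor_product_neg:
  assumes "X \<in> tensor_product sA A sB B"
  shows "uminus ` X \<in> tensor_product sA A sB B"
  using assms by (elim tensor_productE) (simp add: coset_neg tensor_productI in_keys_iff subset_iff)

lemma tensor_product_swap: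
  assumes "X \<in> tensor_product sA A sB B"
  shows "tensor_swap sA A sB B X \<in> tensor_product sB B sA A"
proof -
  obtain p where p: "Poly_Mapping.keys p \<subseteq> A \<times> B" "X = p +o tensor_null sA A sB B"
    using assms by (rule tensor_productE)
  show ?thesis
    unfolding p(2) tensor_swap_coset by (rule tensor_productI, rule keys_free_extend[OF _ p(1)]) auto
qed

lemma tensor_product_map:
  assumes "linear_on sA A sC C g" "linear_on sB B sD D h" "X \<in> tensor_product sA A sB B"
  shows "tensor_map sC C sD D g h X \<in> tensor_product sC C sD D"
proof -
  obtain p where p: "Poly_Mapping.keys p \<subseteq> A \<times> B" "X = p +o tensor_null sA A sB B"
    using assms(3) by (rule tensor_productE)
  show ?thesis
    unfolding p(2) tensor_map_coset[OF assms(1,2)]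
    by (rule tensor_productI, rule keys_free_extend[OF _ p(1)])
      (use assms(1,2) in \<open>auto simp: linear_on_def\<close>)
qed

lemma tensor_map_add:
  assumes "linear_on sA A sC C g" "linear_on sB B sD D h"
    and "X \<in> tensor_product sA A sB B" "Y \<in> tensor_product sA A sB B"
  shows "tensor_map sC C sD D g h (X + Y) = tensor_map sC C sD D g h X + tensor_map sC C sD D g h Y"
  using assms(3,4)
  by (elim tensor_productE) (simp add: coset_add tensor_map_coset[OF assms(1,2)] free_extend_add)

lemma tensor_map_neg:
  assumes "linear_on sA A sC C g" "linear_on sB B sD D h" "X \<in> tensor_product sA A sB B"
  shows "tensor_map sC C sD D g h (uminus ` X) = uminus ` tensor_map sC C sD D g h X"
  using assms(3)
  by (elim tensor_productE) (simp add: coset_neg tensor_map_coset[OF assms(1,2)] free_extend_neg)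

lemma tensor_map_scale:
  assumes "linear_on sA A sC C g" "linear_on sB B sD D h" "X \<in> tensor_product sA A sB B"
  shows "tensor_map sC C sD D g h (tensor_scale sA A sB B c X) =
    tensor_scale sC C sD D c (tensor_map sC C sD D g h X)"
  using assms(3)
  by (elim tensor_productE)
    (simp add: tensor_scale_coset tensor_map_coset[OF assms(1,2)] free_extend_scale)

lemma tensor_map_comp:
  assumes "linear_on sA A sC C g" "linear_on sB B sD D h"
    and "linear_on sC C sC' C' g'" "linear_on sD D sD' D' h'"
    and "X \<in> tensor_product sA A sB B"
  shows "tensor_map sC' C' sD' D' g' h' (tensor_map sC C sD D g h X) =
    tensor_map sC' C' sD' D' (\<lambda>a. g' (g a)) (\<lambda>b. h' (h b)) X"
  using assms(5)
  by (elim tensor_productE)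
    (simp add: tensor_map_coset[OF assms(1,2)] tensor_map_coset[OF assms(3,4)] free_extend_comp
      tensor_map_coset[OF linear_on_comp[OF assms(1,3)] linear_on_comp[OF assms(2,4)]]
      case_prod_unfold)

text \<open>Outside the carriers the maps may differ, so a representative supported in
  \<open>A \<times> B\<close> is taken; on it the two induced maps coincide exactly.\<close>

lemma tensor_map_cong:
  assumes "linear_on sA A sC C g" "linear_on sB B sD D h"
    and "linear_on sA A sC C g'" "linear_on sB B sD D h'"
    and "\<And>a. a \<in> A \<Longrightarrow> g a = g' a" "\<And>b. b \<in> B \<Longrightarrow> h b = h' b"
    and "X \<in> tensor_product sA A sB B"
  shows "tensor_map sC C sD D g h X = tensor_map sC C sD D g' h' X"
proof -
  obtain p where p: "Poly_Mapping.keys p \<subseteq> A \<times> B" "X = p +o tensor_null sA A sB B"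
    using assms(7) by (rule tensor_productE)
  have "free_extend (\<lambda>(a, b). free_gen (g a, h b)) p = free_extend (\<lambda>(a, b). free_gen (g' a, h' b)) p"
    using p(1) by (intro free_extend_cong) (auto simp: assms(5,6))
  then show ?thesis
    by (simp add: p(2) tensor_map_coset[OF assms(1,2)] tensor_map_coset[OF assms(3,4)])
qed

lemma tensor_map_swap:
  assumes "linear_on sA A sC C g" "linear_on sB B sD D h" "X \<in> tensor_product sA A sB B"
  shows "tensor_map sD D sC C h g (tensor_swap sA A sB B X) =
    tensor_swap sC C sD D (tensor_map sC C sD D g h X)"
  using assms(3)
  by (elim tensor_productE)
    (simp add: tensor_swap_coset tensor_map_coset[OF assms(1,2)] tensor_map_coset[OF assms(2,1)]
      free_extend_comp case_prod_unfold)

text \<open>Unlike the preceding laws, this one does not come from an identity in the free vector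
  space: the generator at \<open>(g a + g' a, h b)\<close> differs from the sum of the two
  generators by an additivity relation.\<close>

lemma tensor_map_fun_add_left:
  assumes "vector_space sC" "module.subspace sC C"
    and "linear_on sA A sC C g" "linear_on sA A sC C g'" "linear_on sB B sD D h"
    and "X \<in> tensor_product sA A sB B"
  shows "tensor_map sC C sD D (\<lambda>a. g a + g' a) h X =
    tensor_map sC C sD D g h X + tensor_map sC C sD D g' h X"
proof -
  obtain p where p: "Poly_Mapping.keys p \<subseteq> A \<times> B" "X = p +o tensor_null sA A sB B"
    using assms(6) by (rule tensor_productE)
  have "free_extend (\<lambda>(a, b). free_gen (g a + g' a, h b)) p -
      free_extend (\<lambda>x. (case x of (a, b) \<Rightarrow> free_gen (g a, h b)) + (case x of (a, b) \<Rightarrow> free_gen (g' a, h b))) p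
      \<in> tensor_null sC C sD D"
    using assms(3-5) p(1)
    by (intro free_extend_cong_mod[of _ "A \<times> B"])
      (auto simp: linear_on_def diff_diff_eq[symmetric] intro: tensor_null_relations)
  then show ?thesis
    using assms
    by (simp add: p(2) tensor_map_coset linear_on_add coset_add coset_eq_iff free_extend_fun_add)
qed

lemma tensor_map_fun_add_right:
  assumes "vector_space sD" "module.subspace sD D"
    and "linear_on sA A sC C g" "linear_on sB B sD D h" "linear_on sB B sD D h'"
    and "X \<in> tensor_product sA A sB B"
  shows "tensor_map sC C sD D g (\<lambda>b. h b + h' b) X =
    tensor_map sC C sD D g h X + tensor_map sC C sD D g h' X"
proof -
  obtain p where p: "Poly_Mapping.keys p \<subseteq> A \<times> B" "X = p +o tensor_null sA A sB B"
    using assms(6) by (rule tensor_productE)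
  have "free_extend (\<lambda>(a, b). free_gen (g a, h b + h' b)) p -
      free_extend (\<lambda>x. (case x of (a, b) \<Rightarrow> free_gen (g a, h b)) + (case x of (a, b) \<Rightarrow> free_gen (g a, h' b))) p
      \<in> tensor_null sC C sD D"
    using assms(3-5) p(1)
    by (intro free_extend_cong_mod[of _ "A \<times> B"])
      (auto simp: linear_on_def diff_diff_eq[symmetric] intro: tensor_null_relations)
  then show ?thesis
    using assms
    by (simp add: p(2) tensor_map_coset linear_on_add coset_add coset_eq_iff free_extend_fun_add)
qed

lemma tensor_linear_on_map:
  assumes "tensor_linear_on sE E sA A sB B \<delta>" "linear_on sA A sC C g" "linear_on sB B sD D h"
  shows "tensor_linear_on sE E sC C sD D (\<lambda>x. tensor_map sC C sD D g h (\<delta> x))"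
  using assms(1) unfolding tensor_linear_on_def
  by (simp add: tensor_product_map[OF assms(2,3)] tensor_map_add[OF assms(2,3)]
      tensor_map_scale[OF assms(2,3)])

section \<open>Transport of Lie bialgebra structures\<close>

lemma free_extend_swap12_tensor3_null:
  assumes "n \<in> tensor3_null s A"
  shows "free_extend (\<lambda>(a, b, c). free_gen (b, a, c)) n \<in> tensor3_null s A"
  by (rule free_extend_tensor3_null[OF subspace_tensor3_null _ _ _ _ _ _ assms])
    (auto intro: tensor3_null_relations)

lemma tensor3_swap12_coset:
  "tensor3_swap12 s A (p +o tensor3_null s A) =
    free_extend (\<lambda>(a, b, c). free_gen (b, a, c)) p +o tensor3_null s A"
  unfolding tensor3_swap12_def
  by (rule coset_free_extend) (auto intro: free_extend_swap12_tensor3_null)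

lemma free_extend_map_tensor3_null:
  assumes "linear_on s A s' A' \<phi>" "n \<in> tensor3_null s A"
  shows "free_extend (\<lambda>(a, b, c). free_gen (\<phi> a, \<phi> b, \<phi> c)) n \<in> tensor3_null s' A'"
  by (rule free_extend_tensor3_null[OF subspace_tensor3_null _ _ _ _ _ _ assms(2)])
    (use assms(1) in \<open>auto simp: linear_on_def intro: tensor3_null_relations\<close>)

text \<open>\<open>outer_left\<close> underlies \<open>I \<otimes> \<delta>\<close> and \<open>outer_right\<close> underlies \<open>\<delta> \<otimes> I\<close>.\<close>

definition outer_left :: "'a \<Rightarrow> 'a \<times> 'a \<Rightarrow> 'a \<times> 'a \<times> 'a"
  where "outer_left a = (\<lambda>(c, d). (a, c, d))"

definition outer_right :: "'a \<Rightarrow> 'a \<times> 'a \<Rightarrow> 'a \<times> 'a \<times> 'a"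
  where "outer_right a = (\<lambda>(c, d). (c, d, a))"

text \<open>Inserting a fixed factor on either side turns a bilinearity relation into one of the
  triple relations. Hence another representative of a cobracket changes the result only within
  \<open>tensor3_null\<close>.\<close>

lemma free_extend_outer_tensor_null:
  assumes "e = outer_left \<or> e = outer_right" "a \<in> L" "n \<in> tensor_null s L s L"
  shows "free_extend (\<lambda>x. free_gen (e a x)) n \<in> tensor3_null s L"
  by (rule free_extend_tensor_null[OF subspace_tensor3_null _ _ _ _ assms(3)])
    (use assms(1,2) in \<open>auto simp: outer_left_def outer_right_def intro: tensor3_null_relations\<close>)

lemma free_extend_outer_add:
  assumes "e = outer_left \<or> e = outer_right" "a \<in> L" "b \<in> L" "Poly_Mapping.keys p \<subseteq> L \<times> L"
  shows "free_extend (\<lambda>x. free_gen (e (a + b) x)) p - free_extend (\<lambda>x. free_gen (e a x)) p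
    - free_extend (\<lambda>x. free_gen (e b x)) p \<in> tensor3_null s L"
proof -
  have "free_extend (\<lambda>x. free_gen (e (a + b) x)) p -
      free_extend (\<lambda>x. free_gen (e a x) + free_gen (e b x)) p \<in> tensor3_null s L"
    by (rule free_extend_cong_mod[OF subspace_tensor3_null _ assms(4)])
      (use assms(1-3) in \<open>auto simp: outer_left_def outer_right_def diff_diff_eq[symmetric]
        intro: tensor3_null_relations\<close>)
  then show ?thesis by (simp add: free_extend_fun_add diff_diff_eq)
qed

lemma free_extend_outer_scale:
  assumes "e = outer_left \<or> e = outer_right" "a \<in> L" "Poly_Mapping.keys p \<subseteq> L \<times> L"
  shows "free_extend (\<lambda>x. free_gen (e (s c a) x)) p
    - free_scale c (free_extend (\<lambda>x. free_gen (e a x)) p) \<in> tensor3_null s L"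
proof -
  have "free_extend (\<lambda>x. free_gen (e (s c a) x)) p -
      free_extend (\<lambda>x. free_scale c (free_gen (e a x))) p \<in> tensor3_null s L"
    by (rule free_extend_cong_mod[OF subspace_tensor3_null _ assms(3)])
      (use assms(1,2) in \<open>auto simp: outer_left_def outer_right_def intro: tensor3_null_relations\<close>)
  then show ?thesis by (simp add: free_extend_fun_scale)
qed

text \<open>Needed for an arbitrary member \<open>q\<close>, since the one picked by
  \<open>SOME\<close> is not controlled. It differs from a representative with support in
  \<open>L \<times> L\<close> by a null element, whose support also lies there.\<close>

lemma tensor_linear_on_rep:
  assumes "vector_space s" "module.subspace s L" "tensor_linear_on s L s L s L \<delta>" "b \<in> L" "q \<in> \<delta> b"
  shows "\<delta> b = q +o tensor_null s L s L" "Poly_Mapping.keys q \<subseteq> L \<times> L"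
proof -
  have "\<delta> b \<in> tensor_product s L s L" using assms(3,4) by (auto simp: tensor_linear_on_def)
  then obtain p where p: "Poly_Mapping.keys p \<subseteq> L \<times> L" "\<delta> b = p +o tensor_null s L s L"
    by (rule tensor_productE)
  with assms(5) have q: "q \<in> p +o tensor_null s L s L" by simp
  then show "\<delta> b = q +o tensor_null s L s L" using coset_of_mem p(2) subspace_tensor_null by metis
  from q have "Poly_Mapping.keys (q - p) \<subseteq> L \<times> L"
    using keys_tensor_null[OF assms(1,2)] by (simp add: in_coset_iff)
  then show "Poly_Mapping.keys q \<subseteq> L \<times> L" using keys_add[of "q - p" p] p(1) by auto
qed

lemma tensor_linear_on_SOME:
  assumes "tensor_linear_on s L s L s L \<delta>" "b \<in> L"
  shows "(SOME q. q \<in> \<delta> b) \<in> \<delta> b"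
proof -
  have "\<delta> b \<in> tensor_product s L s L" using assms by (auto simp: tensor_linear_on_def)
  then obtain p where "\<delta> b = p +o tensor_null s L s L"
    by (rule tensor_productE)
  then have "p \<in> \<delta> b" using coset_self subspace_tensor_null by metis
  then show ?thesis by (rule someI)
qed

text \<open>For \<open>outer_left\<close> this represents \<open>a \<otimes> \<delta> b\<close>, for
  \<open>outer_right\<close> it represents \<open>\<delta> b \<otimes> a\<close>. The factor left
  untouched is the first argument in both cases, so both can be treated together.\<close>

definition outer_cobracket ::
  "('a \<Rightarrow> 'a \<times> 'a \<Rightarrow> 'x) \<Rightarrow> ('a \<Rightarrow> ('a \<times> 'a \<Rightarrow>\<^sub>0 'k::field) set) \<Rightarrow> 'a \<Rightarrow> 'a \<Rightarrow> 'x \<Rightarrow>\<^sub>0 'k"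
  where "outer_cobracket e \<delta> a b = free_extend (\<lambda>x. free_gen (e a x)) (SOME q. q \<in> \<delta> b)"

text \<open>In \<open>a\<close>, linearity is a relation of the outer slot, applied to each
  generator of the representative. In \<open>b\<close>, the chosen representatives need not depend
  linearly on \<open>b\<close>, but the cosets do; the discrepancy is a null element, which the
  outer insertion sends to \<open>tensor3_null\<close>.\<close>

lemma outer_cobracket_bilinear:
  assumes "vector_space s" "module.subspace s L" "tensor_linear_on s L s L s L \<delta>"
    and e: "e = outer_left \<or> e = outer_right"
  shows "\<lbrakk>a \<in> L; a' \<in> L; b \<in> L\<rbrakk> \<Longrightarrow> outer_cobracket e \<delta> (a + a') b - outer_cobracket e \<delta> a b
      - outer_cobracket e \<delta> a' b \<in> tensor3_null s L"
    and "\<lbrakk>a \<in> L; b \<in> L\<rbrakk> \<Longrightarrow> outer_cobracket e \<delta> (s c a) b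
      - free_scale c (outer_cobracket e \<delta> a b) \<in> tensor3_null s L"
    and "\<lbrakk>a \<in> L; b \<in> L; b' \<in> L\<rbrakk> \<Longrightarrow> outer_cobracket e \<delta> a (b + b') - outer_cobracket e \<delta> a b
      - outer_cobracket e \<delta> a b' \<in> tensor3_null s L"
    and "\<lbrakk>a \<in> L; b \<in> L\<rbrakk> \<Longrightarrow> outer_cobracket e \<delta> a (s c b)
      - free_scale c (outer_cobracket e \<delta> a b) \<in> tensor3_null s L"
proof -
  interpret vector_space s by fact
  define rep where "rep b = (SOME q. q \<in> \<delta> b)" for b
  have rep: "rep b \<in> \<delta> b" if "b \<in> L" for b
    unfolding rep_def using tensor_linear_on_SOME[OF assms(3) that] .
  note reps = tensor_linear_on_rep[OF assms(1-3) _ rep]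
  have oc: "outer_cobracket e \<delta> a b = free_extend (\<lambda>x. free_gen (e a x)) (rep b)" for a b
    by (simp add: outer_cobracket_def rep_def)
  show "outer_cobracket e \<delta> (a + a') b - outer_cobracket e \<delta> a b
      - outer_cobracket e \<delta> a' b \<in> tensor3_null s L" if "a \<in> L" "a' \<in> L" "b \<in> L"
    unfolding oc using e that reps(2) by (intro free_extend_outer_add) auto
  show "outer_cobracket e \<delta> (s c a) b
      - free_scale c (outer_cobracket e \<delta> a b) \<in> tensor3_null s L" if "a \<in> L" "b \<in> L"
    unfolding oc using e that reps(2) by (intro free_extend_outer_scale) auto
  show "outer_cobracket e \<delta> a (b + b') - outer_cobracket e \<delta> a b
      - outer_cobracket e \<delta> a b' \<in> tensor3_null s L" if "a \<in> L" "b \<in> L" "b' \<in> L"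
  proof -
    have "\<delta> (b + b') = \<delta> b + \<delta> b'"
      using that assms(3) by (auto simp: tensor_linear_on_def)
    also have "\<dots> = (rep b + rep b') +o tensor_null s L s L"
      using reps(1)[OF that(2) that(2)] reps(1)[OF that(3) that(3)] coset_add subspace_tensor_null by metis
    finally have "rep (b + b') - (rep b + rep b') \<in> tensor_null s L s L"
      using rep[OF subspace_add[OF assms(2) that(2,3)]] by (simp add: in_coset_iff)
    from free_extend_outer_tensor_null[OF e that(1) this] show ?thesis
      unfolding oc by (simp add: free_extend_diff free_extend_add diff_diff_eq)
  qed
  show "outer_cobracket e \<delta> a (s c b)
      - free_scale c (outer_cobracket e \<delta> a b) \<in> tensor3_null s L" if "a \<in> L" "b \<in> L"
  proof -
    have "\<delta> (s c b) = tensor_scale s L s L c (\<delta> b)"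
      using that assms(3) by (auto simp: tensor_linear_on_def)
    also have "\<dots> = free_scale c (rep b) +o tensor_null s L s L"
      using reps(1)[OF that(2) that(2)] tensor_scale_coset by metis
    finally have "rep (s c b) - free_scale c (rep b) \<in> tensor_null s L s L"
      using rep[OF subspace_scale[OF assms(2) that(2), of c]] by (simp add: in_coset_iff)
    from free_extend_outer_tensor_null[OF e that(1) this] show ?thesis
      unfolding oc by (simp add: free_extend_diff free_extend_scale)
  qed
qed

text \<open>Bilinearity modulo \<open>tensor3_null\<close> is enough for
  \<open>I \<otimes> \<delta>\<close> to descend to the tensor product and to be evaluated on any
  representative.\<close>

lemma tensor_id_left_coset:
  assumes "vector_space s" "module.subspace s L" "tensor_linear_on s L s L s L \<delta>"
  shows "tensor_id_left s L \<delta> (p +o tensor_null s L s L) =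
    free_extend (\<lambda>(a, b). outer_cobracket outer_left \<delta> a b) p +o tensor3_null s L"
proof -
  have eq: "free_extend (\<lambda>(c, d). free_gen (a, c, d)) (SOME q. q \<in> \<delta> b) =
      outer_cobracket outer_left \<delta> a b" for a b
    by (simp add: outer_cobracket_def outer_left_def case_prod_unfold)
  note bilinear = outer_cobracket_bilinear[OF assms disjI1[OF refl]]
  show ?thesis
    unfolding tensor_id_left_def eq
  proof (rule coset_free_extend[OF subspace_tensor3_null subspace_tensor_null])
    fix n assume n: "n \<in> tensor_null s L s L"
    show "free_extend (\<lambda>(a, b). outer_cobracket outer_left \<delta> a b) n \<in> tensor3_null s L"
      by (rule free_extend_tensor_null[OF subspace_tensor3_null _ _ _ _ n]) (simp_all add: bilinear)
  qed
qed

text \<open>As for \<open>I \<otimes> \<delta>\<close>; the arguments of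
  \<open>outer_cobracket\<close> are exchanged because \<open>\<delta> \<otimes> I\<close> leaves
  the second factor \<open>b\<close> untouched.\<close>

lemma tensor_id_right_coset:
  assumes "vector_space s" "module.subspace s L" "tensor_linear_on s L s L s L \<delta>"
  shows "tensor_id_right s L \<delta> (p +o tensor_null s L s L) =
    free_extend (\<lambda>(a, b). outer_cobracket outer_right \<delta> b a) p +o tensor3_null s L"
proof -
  have eq: "free_extend (\<lambda>(c, d). free_gen (c, d, b)) (SOME q. q \<in> \<delta> a) =
      outer_cobracket outer_right \<delta> b a" for a b
    by (simp add: outer_cobracket_def outer_right_def case_prod_unfold)
  note bilinear = outer_cobracket_bilinear[OF assms disjI2[OF refl]]
  show ?thesis
    unfolding tensor_id_right_def eq
  proof (rule coset_free_extend[OF subspace_tensor3_null subspace_tensor_null])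
    fix n assume n: "n \<in> tensor_null s L s L"
    show "free_extend (\<lambda>(a, b). outer_cobracket outer_right \<delta> b a) n \<in> tensor3_null s L"
      by (rule free_extend_tensor_null[OF subspace_tensor3_null _ _ _ _ n]) (simp_all add: bilinear)
  qed
qed

text \<open>The representative chosen for \<open>\<delta>' (\<phi> b)\<close> and the image of the
  one chosen for \<open>\<delta> b\<close> lie in the same coset, so they differ by a null element.
  Inserting the outer factor commutes with applying \<open>\<phi>\<close> in every slot.\<close>

lemma outer_cobracket_transport:
  fixes \<phi> :: "'a::ab_group_add \<Rightarrow> 'b::ab_group_add" and s :: "'k::field \<Rightarrow> 'a \<Rightarrow> 'a"
  assumes "vector_space s" "module.subspace s L" "tensor_linear_on s L s L s L \<delta>"
    and "tensor_linear_on s' L' s' L' s' L' \<delta>'"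
    and \<phi>: "linear_on s L s' L' \<phi>"
    and \<delta>': "\<And>x. x \<in> L \<Longrightarrow> \<delta>' (\<phi> x) = tensor_map s' L' s' L' \<phi> \<phi> (\<delta> x)"
    and e: "(e, e') = (outer_left, outer_left) \<or> (e, e') = (outer_right, outer_right)"
    and "a \<in> L" "b \<in> L"
  shows "outer_cobracket e' \<delta>' (\<phi> a) (\<phi> b)
    - free_extend (\<lambda>(a, b, c). free_gen (\<phi> a, \<phi> b, \<phi> c)) (outer_cobracket e \<delta> a b)
    \<in> tensor3_null s' L'"
proof -
  define q where "q = (SOME q. q \<in> \<delta> b)"
  define q' where "q' = (SOME q. q \<in> \<delta>' (\<phi> b))"
  have \<phi>L: "\<phi> x \<in> L'" if "x \<in> L" for x using \<phi> that by (auto simp: linear_on_def)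
  have "q \<in> \<delta> b" unfolding q_def using tensor_linear_on_SOME[OF assms(3,9)] .
  note q = tensor_linear_on_rep[OF assms(1-3,9) this]
  have "q' \<in> \<delta>' (\<phi> b)" unfolding q'_def using tensor_linear_on_SOME[OF assms(4) \<phi>L[OF assms(9)]] .
  then have "q' - free_extend (\<lambda>(a, b). free_gen (\<phi> a, \<phi> b)) q \<in> tensor_null s' L' s' L'"
    by (simp add: \<delta>'[OF assms(9)] q(1) tensor_map_coset[OF \<phi> \<phi>] in_coset_iff)
  then have *: "free_extend (\<lambda>x. free_gen (e' (\<phi> a) x))
      (q' - free_extend (\<lambda>(a, b). free_gen (\<phi> a, \<phi> b)) q) \<in> tensor3_null s' L'"
    using e \<phi>L[OF assms(8)] by (intro free_extend_outer_tensor_null) auto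
  have "free_extend (\<lambda>(a, b, c). free_gen (\<phi> a, \<phi> b, \<phi> c)) (free_extend (\<lambda>x. free_gen (e a x)) q) =
      free_extend (\<lambda>x. free_gen (e' (\<phi> a) x)) (free_extend (\<lambda>(a, b). free_gen (\<phi> a, \<phi> b)) q)"
    unfolding free_extend_comp using e
    by (intro free_extend_cong) (auto simp: outer_left_def outer_right_def)
  with * show ?thesis
    by (simp add: outer_cobracket_def q_def[symmetric] q'_def[symmetric] free_extend_diff)
qed

text \<open>Reduces compatibility of two induced maps with \<open>\<phi>\<close> to pairs of
  elements of \<open>L\<close>. It serves both \<open>I \<otimes> \<delta>\<close> and
  \<open>\<delta> \<otimes> I\<close>, with \<open>F\<close> applying \<open>\<phi>\<close> in all
  three slots.\<close>

lemma free_extend_transport: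
  fixes \<phi> :: "'a::ab_group_add \<Rightarrow> 'b::ab_group_add"
  assumes "free.subspace N" "Poly_Mapping.keys p \<subseteq> L \<times> L"
    and "\<And>a b. a \<in> L \<Longrightarrow> b \<in> L \<Longrightarrow> h' (\<phi> a, \<phi> b) - free_extend F (h (a, b)) \<in> N"
  shows "free_extend h' (free_extend (\<lambda>(a, b). free_gen (\<phi> a, \<phi> b)) p)
    - free_extend F (free_extend h p) \<in> N"
  unfolding free_extend_comp
  by (rule free_extend_cong_mod[OF assms(1) _ assms(2)]) (use assms(3) in auto)

text \<open>Every axiom is an identity in elements of the carrier. Writing the elements of
  \<open>L'\<close> as values of \<open>\<phi>\<close> turns it into the image under
  \<open>\<phi>\<close> of the same identity in \<open>L\<close>, so a surjective map compatible
  with both operations suffices.\<close>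

lemma lie_bialgebra_transport:
  fixes \<phi> :: "'a::ab_group_add \<Rightarrow> 'b::ab_group_add" and s :: "'k::field \<Rightarrow> 'a \<Rightarrow> 'a"
  assumes "lie_bialgebra s L br \<delta>" "vector_space s'" "module.subspace s' L'"
    and \<phi>: "linear_on s L s' L' \<phi>" and surj: "\<phi> ` L = L'"
    and br': "\<And>x y. x \<in> L \<Longrightarrow> y \<in> L \<Longrightarrow> br' (\<phi> x) (\<phi> y) = \<phi> (br x y)"
    and \<delta>': "\<And>x. x \<in> L \<Longrightarrow> \<delta>' (\<phi> x) = tensor_map s' L' s' L' \<phi> \<phi> (\<delta> x)"
  shows "lie_bialgebra s' L' br' \<delta>'"
proof -
  interpret A: lie_bialgebra s L br \<delta> by fact
  interpret B: vector_space s' by fact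
  let ?T = "tensor_map s' L' s' L' \<phi> \<phi>"
  let ?N' = "tensor_null s' L' s' L'"
  let ?N3 = "tensor3_null s L" and ?N3' = "tensor3_null s' L'"
  note L = A.subspace_carrier
  have \<phi>_add: "\<phi> (x + y) = \<phi> x + \<phi> y" if "x \<in> L" "y \<in> L" for x y
    using \<phi> that by (simp add: linear_on_def)
  have \<phi>_scale: "\<phi> (s c x) = s' c (\<phi> x)" if "x \<in> L" for c x
    using \<phi> that by (simp add: linear_on_def)
  have \<phi>0: "\<phi> 0 = 0"
    using \<phi>_add[OF A.subspace_0[OF L] A.subspace_0[OF L]] by simp
  have br_closed [intro]: "br x y \<in> L" if "x \<in> L" "y \<in> L" for x y
    using A.bracket_bilinear that by (simp add: bilinear_on_def linear_on_def)
  have br_linear: "linear_on s L s L (br x)" if "x \<in> L" for x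
    using A.bracket_bilinear that by (simp add: bilinear_on_def)
  have br_linear': "linear_on s L s L (\<lambda>x. br x y)" if "y \<in> L" for y
    using A.bracket_bilinear that by (simp add: bilinear_on_def)
  have \<delta>_prod: "\<delta> x \<in> tensor_product s L s L" if "x \<in> L" for x
    using A.cobracket_linear that by (simp add: tensor_linear_on_def)
  have onto: "\<forall>y\<in>L'. P y" if "\<And>x. x \<in> L \<Longrightarrow> P (\<phi> x)" for P
    using that surj by blast

  have linear1: "linear_on s' L' s' L' (br' y)" if "y \<in> L'" for y
  proof -
    from that surj obtain x where x: "x \<in> L" "y = \<phi> x" by blast
    have "\<phi> (br x (u + v)) = \<phi> (br x u) + \<phi> (br x v)" if "u \<in> L" "v \<in> L" for u v
      using br_linear[OF x(1)] that x(1) by (simp add: linear_on_def \<phi>_add br_closed)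
    moreover have "\<phi> (br x (s c u)) = s' c (\<phi> (br x u))" if "u \<in> L" for c u
      using br_linear[OF x(1)] that x(1) by (simp add: linear_on_def \<phi>_scale br_closed)
    ultimately show ?thesis
      unfolding linear_on_def x(2) surj[symmetric] using x(1)
      by (auto simp: br' \<phi>_add[symmetric] \<phi>_scale[symmetric] A.subspace_add[OF L] A.subspace_scale[OF L])
  qed
  have linear2: "linear_on s' L' s' L' (\<lambda>z. br' z y)" if "y \<in> L'" for y
  proof -
    from that surj obtain x where x: "x \<in> L" "y = \<phi> x" by blast
    have "\<phi> (br (u + v) x) = \<phi> (br u x) + \<phi> (br v x)" if "u \<in> L" "v \<in> L" for u v
      using br_linear'[OF x(1)] that x(1) by (simp add: linear_on_def \<phi>_add br_closed)
    moreover have "\<phi> (br (s c u) x) = s' c (\<phi> (br u x))" if "u \<in> L" for c u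
      using br_linear'[OF x(1)] that x(1) by (simp add: linear_on_def \<phi>_scale br_closed)
    ultimately show ?thesis
      unfolding linear_on_def x(2) surj[symmetric] using x(1)
      by (auto simp: br' \<phi>_add[symmetric] \<phi>_scale[symmetric] A.subspace_add[OF L] A.subspace_scale[OF L])
  qed
  have T_linear: "tensor_linear_on s L s' L' s' L' (\<lambda>x. ?T (\<delta> x))"
    by (rule tensor_linear_on_map[OF A.cobracket_linear \<phi> \<phi>])
  \<comment> \<open>By surjectivity, linearity of \<open>\<delta>'\<close> is read off from that of
    its composite with \<open>\<phi>\<close>, which is \<open>\<delta>\<close> followed by
    \<open>\<phi> \<otimes> \<phi>\<close>.\<close>
  have \<delta>'_linear: "tensor_linear_on s' L' s' L' s' L' \<delta>'"
    unfolding tensor_linear_on_def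
    by (intro conjI allI onto)
      (use T_linear in \<open>simp_all add: tensor_linear_on_def \<delta>' \<phi>_add[symmetric] \<phi>_scale[symmetric]
        A.subspace_add[OF L] A.subspace_scale[OF L]\<close>)

  have skew': "\<delta>' y = uminus ` tensor_swap s' L' s' L' (\<delta>' y)" if "y \<in> L'" for y
  proof -
    from that surj obtain x where x: "x \<in> L" "y = \<phi> x" by blast
    have "?T (\<delta> x) = ?T (uminus ` tensor_swap s L s L (\<delta> x))"
      using A.cobracket_skew[OF x(1)] by simp
    also have "\<dots> = uminus ` tensor_swap s' L' s' L' (?T (\<delta> x))"
      by (simp add: tensor_map_neg[OF \<phi> \<phi> tensor_product_swap] tensor_map_swap[OF \<phi> \<phi>] \<delta>_prod x(1))
    finally show ?thesis by (simp add: x \<delta>')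
  qed

  \<comment> \<open>The map \<open>\<phi> \<otimes> \<phi>\<close> intertwines the two actions,
    because on \<open>L\<close> following \<open>br x\<close> by \<open>\<phi>\<close> is the same
    as following \<open>\<phi>\<close> by \<open>br' (\<phi> x)\<close>. Functoriality of
    \<open>tensor_map\<close> transfers this to each of the two summands.\<close>
  have act: "?T (tensor_act s L br x X) = tensor_act s' L' br' (\<phi> x) (?T X)"
    if x: "x \<in> L" and X: "X \<in> tensor_product s L s L" for x X
  proof -
    note id = linear_on_id[of s L] and id' = linear_on_id[of s' L']
    have \<phi>x: "\<phi> x \<in> L'" using x surj by blast
    note lin = br_linear[OF x] linear1[OF \<phi>x]
    have cl: "tensor_map s L s L (br x) (\<lambda>c. c) X \<in> tensor_product s L s L"
      "tensor_map s L s L (\<lambda>c. c) (br x) X \<in> tensor_product s L s L"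
      using tensor_product_map[OF lin(1) id X] tensor_product_map[OF id lin(1) X] .
    have "?T (tensor_map s L s L (br x) (\<lambda>c. c) X) =
        tensor_map s' L' s' L' (\<lambda>b. br' (\<phi> x) (\<phi> b)) \<phi> X"
      unfolding tensor_map_comp[OF lin(1) id \<phi> \<phi> X]
      by (rule tensor_map_cong[OF linear_on_comp[OF lin(1) \<phi>] \<phi> linear_on_comp[OF \<phi> lin(2)] \<phi> _ _ X])
        (simp_all add: br' x)
    moreover have "?T (tensor_map s L s L (\<lambda>c. c) (br x) X) =
        tensor_map s' L' s' L' \<phi> (\<lambda>b. br' (\<phi> x) (\<phi> b)) X"
      unfolding tensor_map_comp[OF id lin(1) \<phi> \<phi> X]
      by (rule tensor_map_cong[OF \<phi> linear_on_comp[OF lin(1) \<phi>] \<phi> linear_on_comp[OF \<phi> lin(2)] _ _ X])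
        (simp_all add: br' x)
    ultimately show ?thesis
      by (simp add: tensor_act_def tensor_map_add[OF \<phi> \<phi> cl]
          tensor_map_comp[OF \<phi> \<phi> lin(2) id' X] tensor_map_comp[OF \<phi> \<phi> id' lin(2) X])
  qed
  have act_closed: "tensor_act s L br x X \<in> tensor_product s L s L"
    if "x \<in> L" "X \<in> tensor_product s L s L" for x X
    unfolding tensor_act_def
    by (intro tensor_product_add tensor_product_map[OF br_linear linear_on_id]
        tensor_product_map[OF linear_on_id br_linear] that)

  have cojacobi': "tensor_id_left s' L' \<delta>' (\<delta>' y)
      + uminus ` tensor3_swap12 s' L' (tensor_id_left s' L' \<delta>' (\<delta>' y))
      = tensor_id_right s' L' \<delta>' (\<delta>' y)" if "y \<in> L'" for y
  proof -
    from that surj obtain x where x: "x \<in> L" "y = \<phi> x" by blast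
    obtain p where p: "Poly_Mapping.keys p \<subseteq> L \<times> L" "\<delta> x = p +o tensor_null s L s L"
      using \<delta>_prod[OF x(1)] by (rule tensor_productE)
    let ?F2 = "free_extend (\<lambda>(a, b). free_gen (\<phi> a, \<phi> b)) :: ('a \<times> 'a \<Rightarrow>\<^sub>0 'k) \<Rightarrow> _"
    let ?F3 = "free_extend (\<lambda>(a, b, c). free_gen (\<phi> a, \<phi> b, \<phi> c)) :: ('a \<times> 'a \<times> 'a \<Rightarrow>\<^sub>0 'k) \<Rightarrow> _"
    let ?\<tau> = "free_extend (\<lambda>(a, b, c). free_gen (b, a, c)) :: ('a \<times> 'a \<times> 'a \<Rightarrow>\<^sub>0 'k) \<Rightarrow> _"
    let ?\<tau>' = "free_extend (\<lambda>(a, b, c). free_gen (b, a, c)) :: ('b \<times> 'b \<times> 'b \<Rightarrow>\<^sub>0 'k) \<Rightarrow> _"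
    let ?l = "free_extend (\<lambda>(a, b). outer_cobracket outer_left \<delta> a b) p"
    let ?r = "free_extend (\<lambda>(a, b). outer_cobracket outer_right \<delta> b a) p"
    note cosets = tensor_id_left_coset[OF A.vector_space_axioms L A.cobracket_linear]
      tensor_id_right_coset[OF A.vector_space_axioms L A.cobracket_linear]
    note cosets' = tensor_id_left_coset[OF assms(2,3) \<delta>'_linear]
      tensor_id_right_coset[OF assms(2,3) \<delta>'_linear]
    note transport = outer_cobracket_transport[OF A.vector_space_axioms L A.cobracket_linear \<delta>'_linear \<phi> \<delta>']
    have \<delta>y: "\<delta>' y = ?F2 p +o ?N'"
      by (simp add: x \<delta>' p(2) tensor_map_coset[OF \<phi> \<phi>])
    \<comment> \<open>Only agreement modulo triple relations can be expected here, since the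
      representatives of \<open>\<delta>\<close> and \<open>\<delta>'\<close> are chosen
      independently.\<close>
    have "free_extend (\<lambda>(a, b). outer_cobracket outer_left \<delta>' a b) (?F2 p) - ?F3 ?l \<in> ?N3'"
      by (rule free_extend_transport[OF subspace_tensor3_null p(1)])
        (use transport[of outer_left outer_left] in simp)
    then have left: "tensor_id_left s' L' \<delta>' (\<delta>' y) = ?F3 ?l +o ?N3'"
      by (simp add: \<delta>y cosets' coset_eq_iff)
    have "free_extend (\<lambda>(a, b). outer_cobracket outer_right \<delta>' b a) (?F2 p) - ?F3 ?r \<in> ?N3'"
      by (rule free_extend_transport[OF subspace_tensor3_null p(1)])
        (use transport[of outer_right outer_right] in simp)
    then have right: "tensor_id_right s' L' \<delta>' (\<delta>' y) = ?F3 ?r +o ?N3'"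
      by (simp add: \<delta>y cosets' coset_eq_iff)
    \<comment> \<open>The co-Jacobi identity, an equality of cosets, becomes membership of one
      element in the triple null space. Applying \<open>\<phi>\<close> in all three slots preserves
      this and commutes with exchanging the first two slots.\<close>
    have "(?l + - ?\<tau> ?l) - ?r \<in> ?N3"
      using A.cojacobi[OF x(1)]
      by (simp add: p(2) cosets tensor3_swap12_coset coset_neg coset_add coset_eq_iff)
    from free_extend_map_tensor3_null[OF \<phi> this]
    have "?F3 ?l - ?F3 (?\<tau> ?l) - ?F3 ?r \<in> ?N3'"
      by (simp add: free_extend_diff)
    moreover have "?F3 (?\<tau> ?l) = ?\<tau>' (?F3 ?l)"
      unfolding free_extend_comp[of _ _ ?l]
      by (intro free_extend_cong) auto
    ultimately show ?thesis
      by (simp add: left right tensor3_swap12_coset coset_neg coset_add coset_eq_iff)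
  qed

  show ?thesis
  proof (intro lie_bialgebra.intro lie_algebra.intro lie_coalgebra.intro
      lie_algebra_axioms.intro lie_coalgebra_axioms.intro lie_bialgebra_axioms.intro)
    show "vector_space s'" "vector_space s'" by fact+
    show "B.subspace L'" "B.subspace L'" by fact+
    show "bilinear_on s' L' s' L' s' L' br'"
      by (simp add: bilinear_on_def linear1 linear2)
    show "tensor_linear_on s' L' s' L' s' L' \<delta>'" by (fact \<delta>'_linear)
  next
    fix x assume "x \<in> L'"
    then show "br' x x = 0"
      using surj by (auto simp: br' A.bracket_alternating \<phi>0)
  next
    fix x y z assume "x \<in> L'" "y \<in> L'" "z \<in> L'"
    then obtain u v w where "u \<in> L" "v \<in> L" "w \<in> L" "x = \<phi> u" "y = \<phi> v" "z = \<phi> w"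
      using surj by blast
    then show "br' x (br' y z) + br' y (br' z x) + br' z (br' x y) = 0"
      by (simp add: br' br_closed \<phi>_add[symmetric] A.subspace_add[OF L] A.jacobi \<phi>0)
  next
    fix x assume "x \<in> L'"
    then show "\<delta>' x = uminus ` tensor_swap s' L' s' L' (\<delta>' x)" by (rule skew')
  next
    fix x assume "x \<in> L'"
    then show "tensor_id_left s' L' \<delta>' (\<delta>' x)
      + uminus ` tensor3_swap12 s' L' (tensor_id_left s' L' \<delta>' (\<delta>' x))
      = tensor_id_right s' L' \<delta>' (\<delta>' x)" by (rule cojacobi')
  next
    fix x y assume "x \<in> L'" "y \<in> L'"
    then obtain u v where uv: "u \<in> L" "v \<in> L" "x = \<phi> u" "y = \<phi> v"
      using surj by blast
    have "\<delta>' (br' x y) = ?T (tensor_act s L br u (\<delta> v) + uminus ` tensor_act s L br v (\<delta> u))"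
      using uv by (simp add: br' \<delta>' br_closed A.cocycle)
    also have "\<dots> = tensor_act s' L' br' x (\<delta>' y) + uminus ` tensor_act s' L' br' y (\<delta>' x)"
      using uv by (simp add: tensor_map_add[OF \<phi> \<phi>] tensor_map_neg[OF \<phi> \<phi>] tensor_product_neg
          act_closed \<delta>_prod act \<delta>')
    finally show "\<delta>' (br' x y) = tensor_act s' L' br' x (\<delta>' y)
      + uminus ` tensor_act s' L' br' y (\<delta>' x)" .
  qed
qed

section \<open>Splitting off a sub-bialgebra\<close>

text \<open>Two candidates for the \<open>G\<close>-component of \<open>x\<close> differ by an
  element of \<open>G \<inter> V\<close>, so the component is unique. Uniqueness also yields
  linearity and the values on \<open>G\<close> and on \<open>V\<close>.\<close>

lemma complement_projection:
  assumes "vector_space s" "module.subspace s G" "module.subspace s V"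
    and "G \<inter> V = {0}" "G + V = E"
  obtains \<pi> where "linear_on s E s G \<pi>" "linear_on s E s V (\<lambda>x. x - \<pi> x)"
    "\<And>x. x \<in> G \<Longrightarrow> \<pi> x = x" "\<And>x. x \<in> V \<Longrightarrow> \<pi> x = 0"
proof -
  interpret vector_space s by fact
  note add = subspace_add[OF assms(2)] subspace_add[OF assms(3)]
    and scale = subspace_scale[OF assms(2)] subspace_scale[OF assms(3)]
    and zero = subspace_0[OF assms(2)] subspace_0[OF assms(3)]
  have unique: "a = b" if "a \<in> G" "b \<in> G" "x - a \<in> V" "x - b \<in> V" for a b x
  proof -
    have "a - b \<in> V"
      using subspace_diff[OF assms(3) that(4,3)] by simp
    then have "a - b \<in> G \<inter> V" using subspace_diff[OF assms(2) that(1,2)] by blast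
    then show ?thesis using assms(4) by simp
  qed
  have "\<exists>a. a \<in> G \<and> x - a \<in> V" if "x \<in> E" for x
  proof -
    from that assms(5) obtain a v where "x = a + v" "a \<in> G" "v \<in> V"
      by (blast elim: set_plus_elim)
    then show ?thesis by (intro exI[of _ a]) simp
  qed
  then obtain \<pi> where \<pi>: "\<And>x. x \<in> E \<Longrightarrow> \<pi> x \<in> G \<and> x - \<pi> x \<in> V" by metis
  have E: "x \<in> E" if "x \<in> G \<or> x \<in> V" for x
    using that assms(5) zero set_plus_intro[of x G 0 V] set_plus_intro[of 0 G x V] by auto
  \<comment> \<open>The sum of the components has the defining property of the component of the sum.
    This also gives closure of \<open>E\<close>, which is known here only as
    \<open>G + V\<close>.\<close>
  have E_add: "x + y \<in> E" and \<pi>_add: "\<pi> (x + y) = \<pi> x + \<pi> y" if "x \<in> E" "y \<in> E" for x y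
  proof -
    have *: "\<pi> x + \<pi> y \<in> G" "x + y - (\<pi> x + \<pi> y) \<in> V"
      using \<pi>[OF that(1)] \<pi>[OF that(2)] by (simp_all only: add add_diff_add)
    show **: "x + y \<in> E" using set_plus_intro[OF *] assms(5) by simp
    show "\<pi> (x + y) = \<pi> x + \<pi> y" using unique[OF _ *(1) _ *(2)] \<pi>[OF **] by blast
  qed
  have \<pi>_scale: "\<pi> (s c x) = s c (\<pi> x)" if "x \<in> E" for c x
  proof -
    have *: "s c (\<pi> x) \<in> G" "s c x - s c (\<pi> x) \<in> V"
      using \<pi>[OF that] by (simp_all only: scale scale_right_diff_distrib[symmetric])
    have "s c x \<in> E" using set_plus_intro[OF *] assms(5) by simp
    then show ?thesis using unique[OF _ *(1) _ *(2)] \<pi> by blast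
  qed
  show ?thesis
  proof
    show "linear_on s E s G \<pi>"
      using \<pi> by (simp add: linear_on_def \<pi>_add \<pi>_scale)
    show "linear_on s E s V (\<lambda>x. x - \<pi> x)"
      using \<pi> by (simp add: linear_on_def \<pi>_add \<pi>_scale scale_right_diff_distrib add_diff_add)
    show "\<pi> x = x" if "x \<in> G" for x
      using unique[of "\<pi> x" x x] \<pi>[OF E, of x] that zero by simp
    show "\<pi> x = 0" if "x \<in> V" for x
      using unique[of "\<pi> x" 0 x] \<pi>[OF E, of x] that zero by simp
  qed
qed

text \<open>Serves all four bilinear maps of the extending datum: \<open>h\<close> is one of the two
  projections of \<open>E\<close>, and \<open>A\<close>, \<open>B\<close> are chosen among
  \<open>G\<close> and \<open>V\<close>.\<close>

lemma bilinear_on_comp: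
  assumes "bilinear_on s E s E s E br" "linear_on s E s' C h" "A \<subseteq> E" "B \<subseteq> E"
  shows "bilinear_on s A s B s' C (\<lambda>x y. h (br x y))"
  unfolding bilinear_on_def
proof (intro conjI ballI)
  fix a assume "a \<in> A"
  then have "linear_on s E s E (br a)" using assms by (auto simp: bilinear_on_def)
  from linear_on_subset[OF linear_on_comp[OF this assms(2)] assms(4)]
  show "linear_on s B s' C (\<lambda>y. h (br a y))" .
next
  fix b assume "b \<in> B"
  then have "linear_on s E s E (\<lambda>a. br a b)" using assms by (auto simp: bilinear_on_def)
  from linear_on_subset[OF linear_on_comp[OF this assms(2)] assms(3)]
  show "linear_on s A s' C (\<lambda>a. h (br a b))" .
qed

lemma tensor_linear_on_subset:
  "tensor_linear_on sE E sA A sB B \<delta> \<Longrightarrow> E' \<subseteq> E \<Longrightarrow> tensor_linear_on sE E' sA A sB B \<delta>"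
  unfolding tensor_linear_on_def by (simp add: subset_iff)

text \<open>Expanding \<open>id = \<iota>\<^sub>G \<pi>\<^sub>G + \<iota>\<^sub>V \<pi>\<^sub>V\<close> in both factors leaves a \<open>V \<otimes> G\<close> component, which
  skewness turns into the flip of the \<open>G \<otimes> V\<close> component.\<close>

lemma skew_tensor_decompose:
  fixes s :: "'k::field \<Rightarrow> 'e::ab_group_add \<Rightarrow> 'e" and s' :: "'k \<Rightarrow> 'f::ab_group_add \<Rightarrow> 'f"
  assumes "vector_space s'" "module.subspace s' P"
    and pG: "linear_on s E sG G pG" and pV: "linear_on s E sV V pV"
    and iG: "linear_on sG G s' P iG" and iV: "linear_on sV V s' P iV"
    and X: "X \<in> tensor_product s E s E" and skew: "X = uminus ` tensor_swap s E s E X"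
  shows "tensor_map s' P s' P (\<lambda>x. iG (pG x) + iV (pV x)) (\<lambda>x. iG (pG x) + iV (pV x)) X =
    tensor_map s' P s' P iG iV (tensor_map sG G sV V pG pV X)
    + uminus ` tensor_map s' P s' P iV iG (tensor_swap sG G sV V (tensor_map sG G sV V pG pV X))
    + tensor_map s' P s' P iG iG (tensor_map sG G sG G pG pG X)
    + tensor_map s' P s' P iV iV (tensor_map sV V sV V pV pV X)"
proof -
  let ?T = "tensor_map s' P s' P"
  let ?gg = "\<lambda>x. iG (pG x)" and ?vv = "\<lambda>x. iV (pV x)"
  have gg: "linear_on s E s' P ?gg" and vv: "linear_on s E s' P ?vv"
    using linear_on_comp[OF pG iG] linear_on_comp[OF pV iV] .
  have sum: "linear_on s E s' P (\<lambda>x. ?gg x + ?vv x)"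
    by (rule linear_on_add[OF assms(1,2) gg vv])
  note Xs = tensor_product_swap[OF X]
  have "?T ?vv ?gg X = ?T ?vv ?gg (uminus ` tensor_swap s E s E X)"
    using skew by simp
  also have "\<dots> = uminus ` ?T iV iG (tensor_map sV V sG G pV pG (tensor_swap s E s E X))"
    by (simp add: tensor_map_neg[OF vv gg Xs] tensor_map_comp[OF pV pG iV iG Xs])
  also have "\<dots> = uminus ` ?T iV iG (tensor_swap sG G sV V (tensor_map sG G sV V pG pV X))"
    by (simp add: tensor_map_swap[OF pG pV X])
  finally have vg: "?T ?vv ?gg X =
      uminus ` ?T iV iG (tensor_swap sG G sV V (tensor_map sG G sV V pG pV X))" .
  have "?T (\<lambda>x. ?gg x + ?vv x) (\<lambda>x. ?gg x + ?vv x) X =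
      (?T ?gg ?gg X + ?T ?gg ?vv X) + (?T ?vv ?gg X + ?T ?vv ?vv X)"
    by (simp only: tensor_map_fun_add_left[OF assms(1,2) gg vv sum X]
        tensor_map_fun_add_right[OF assms(1,2) gg gg vv X]
        tensor_map_fun_add_right[OF assms(1,2) vv gg vv X])
  also have "\<dots> = ?T ?gg ?vv X + ?T ?vv ?gg X + ?T ?gg ?gg X + ?T ?vv ?vv X"
    by (simp only: add.assoc add.commute add.left_commute)
  finally show ?thesis
    by (simp add: vg tensor_map_comp[OF pG pV iG iV X] tensor_map_comp[OF pG pG iG iG X]
        tensor_map_comp[OF pV pV iV iV X])
qed

section \<open>The extending datum and the isomorphism\<close>

theorem theorem4p3:
  fixes s :: "'k::field_char_0 \<Rightarrow> 'e::ab_group_add \<Rightarrow> 'e"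
    and G V E :: "'e set"
    and brG brE :: "'e \<Rightarrow> 'e \<Rightarrow> 'e"
    and \<delta>G \<delta>E :: "'e \<Rightarrow> ('e \<times> 'e \<Rightarrow>\<^sub>0 'k) set"
  assumes "vector_space s"
    and "lie_bialgebra s G brG \<delta>G"
    and "module.subspace s E" and "G \<subseteq> E"
    and "module.subspace s V" and "G \<inter> V = {0}" and "G + V = E"
    and "lie_bialgebra s E brE \<delta>E"
    and "lie_sub_bialgebra s G brG \<delta>G E brE \<delta>E"
  shows "\<exists>\<Omega> :: ('k, 'e, 'e) extending_datum.
    lie_bialgebraic_extending_structure s G brG \<delta>G s V \<Omega> \<and>
    lie_bialgebra_isomorphic s E brE \<delta>E
      (module_prod.scale s s) (G \<times> V) (unified_bracket brG \<Omega>) (unified_cobracket s G \<delta>G s V \<Omega>)"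
proof -
  interpret G: lie_bialgebra s G brG \<delta>G by fact
  interpret E: lie_bialgebra s E brE \<delta>E by fact
  interpret prod: vector_space_prod s s by unfold_locales
  note subG = G.subspace_carrier and subE = \<open>G.subspace E\<close> and subV = \<open>G.subspace V\<close>
  have brG: "brE a b = brG a b" if "a \<in> G" "b \<in> G" for a b
    using assms(9) that by (simp add: lie_sub_bialgebra_def)
  have \<delta>G: "\<delta>E a = tensor_map s E s E (\<lambda>x. x) (\<lambda>x. x) (\<delta>G a)" if "a \<in> G" for a
    using assms(9) that by (simp add: lie_sub_bialgebra_def)
  have GE: "G \<subseteq> E" by fact
  have VE: "V \<subseteq> E"
    using set_zero_plus2[OF G.subspace_0[OF subG], of V] assms(7) by simp
  obtain pG where pG: "linear_on s E s G pG" and pV: "linear_on s E s V (\<lambda>x. x - pG x)"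
    and pG_G: "\<And>x. x \<in> G \<Longrightarrow> pG x = x" and pG_V: "\<And>x. x \<in> V \<Longrightarrow> pG x = 0"
    by (rule complement_projection[OF assms(1) subG subV assms(6,7)]) (rule that; (assumption | simp))
  \<comment> \<open>Defined as the remainder, so that \<open>pG x + pV x = x\<close> holds by
    definition. The splitting of \<open>x\<close> below and the left inverse of
    \<open>\<phi>\<close> both rest on this.\<close>
  define pV where "pV x = x - pG x" for x
  have pV: "linear_on s E s V pV"
    using pV by (simp add: pV_def[abs_def])
  define \<Omega> :: "('k, 'e, 'e) extending_datum" where "\<Omega> = \<lparr>
    ltri = \<lambda>x b. pV (brE x b), rtri = \<lambda>x b. pG (brE x b),
    cocyc = \<lambda>x y. pG (brE x y), vbr = \<lambda>x y. pV (brE x y),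
    DeltaE = \<lambda>x. tensor_map s G s V pG pV (\<delta>E x),
    DeltaV = \<lambda>x. tensor_map s G s G pG pG (\<delta>E x),
    deltaV = \<lambda>x. tensor_map s V s V pV pV (\<delta>E x)\<rparr>"
  let ?s = "prod.scale" and ?P = "G \<times> V"
  let ?br = "unified_bracket brG \<Omega>" and ?\<delta> = "unified_cobracket s G \<delta>G s V \<Omega>"
  let ?T = "tensor_map ?s ?P ?s ?P"
  define iG :: "'e \<Rightarrow> 'e \<times> 'e" where "iG a = (a, 0)" for a
  define iV :: "'e \<Rightarrow> 'e \<times> 'e" where "iV x = (0, x)" for x
  \<comment> \<open>Written as a sum of two composites to match
    \<open>skew_tensor_decompose\<close>; \<open>\<phi>_eq\<close> gives the pair used in
    computations.\<close>
  define \<phi> where "\<phi> x = iG (pG x) + iV (pV x)" for x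
  have \<phi>_eq: "\<phi> x = (pG x, pV x)" for x
    by (simp add: \<phi>_def iG_def iV_def)
  have vsP: "vector_space ?s" by (rule prod.p.vector_space_axioms)
  have subP: "module.subspace ?s ?P"
    using prod.subspace_Times[OF subG subV] .
  have iG: "linear_on s G ?s ?P iG" and iV: "linear_on s V ?s ?P iV"
    using G.subspace_0[OF subG] G.subspace_0[OF subV]
    by (simp_all add: linear_on_def iG_def iV_def prod.scale_def)
  have \<phi>: "linear_on s E ?s ?P \<phi>"
    unfolding \<phi>_def[abs_def]
    by (rule linear_on_add[OF vsP subP linear_on_comp[OF pG iG] linear_on_comp[OF pV iV]])
  have pGE: "pG x \<in> G" and pVE: "pV x \<in> V" if "x \<in> E" for x
    using pG pV that by (auto simp: linear_on_def)
  have pV_G: "pV a = 0" if "a \<in> G" for a using that by (simp add: pV_def pG_G)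
  have pV_V: "pV x = x" if "x \<in> V" for x using that by (simp add: pV_def pG_V)

  have datum: "is_extending_datum s G s V \<Omega>"
    unfolding is_extending_datum_def \<Omega>_def extending_datum.simps
    by (intro conjI bilinear_on_comp[OF E.bracket_bilinear] pG pV GE VE
        tensor_linear_on_map[OF tensor_linear_on_subset[OF E.cobracket_linear VE]])

  have bracket: "?br (\<phi> x) (\<phi> y) = \<phi> (brE x y)" if "x \<in> E" "y \<in> E" for x y
  proof -
    let ?a = "pG x" and ?u = "pV x" and ?b = "pG y" and ?v = "pV y"
    have mem: "?a \<in> E" "?u \<in> E" "?b \<in> E" "?v \<in> E" and memG: "?a \<in> G" "?b \<in> G"
      using pGE pVE GE VE that by auto
    have closed: "brE z w \<in> E" if "z \<in> E" "w \<in> E" for z w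
      using E.bracket_bilinear that by (simp add: bilinear_on_def linear_on_def)
    have add: "brE (z + z') w = brE z w + brE z' w" "brE w (z + z') = brE w z + brE w z'"
      if "z \<in> E" "z' \<in> E" "w \<in> E" for z z' w
      using E.bracket_bilinear that by (simp_all add: bilinear_on_def linear_on_def)
    note E_add = G.subspace_add[OF subE]
    have anti: "brE z w = - brE w z" if "z \<in> E" "w \<in> E" for z w
    proof -
      have "brE z w + brE w z = 0"
        using E.bracket_alternating[OF E_add[OF that]] E.bracket_alternating[OF that(1)]
          E.bracket_alternating[OF that(2)] that by (simp add: add E_add add.commute)
      then show ?thesis by (simp add: eq_neg_iff_add_eq_0)
    qed
    have linp: "pG (z + w) = pG z + pG w" "pV (z + w) = pV z + pV w" if "z \<in> E" "w \<in> E" for z w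
      using pG pV that by (simp_all add: linear_on_def)
    have diffp: "pG (z - w) = pG z - pG w" "pV (z - w) = pV z - pV w" if "z \<in> E" "w \<in> E" for z w
      using linp[OF G.subspace_diff[OF subE that] that(2)] by (simp_all add: eq_diff_eq)
    \<comment> \<open>Of the four terms of the expansion, the one pairing \<open>?a\<close> with
      \<open>?v\<close> is reversed by antisymmetry: the maps of the datum take their argument from
      \<open>V\<close> first.\<close>
    have "brE x y = brE (?a + ?u) (?b + ?v)" by (simp add: pV_def)
    also have "\<dots> = brE ?a ?b + brE ?u ?b - brE ?v ?a + brE ?u ?v"
      using mem by (simp add: add E_add anti[of ?a ?v])
    finally have eq: "brE x y = brE ?a ?b + brE ?u ?b - brE ?v ?a + brE ?u ?v" .
    \<comment> \<open>Since the bracket of two elements of \<open>G\<close> stays in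
      \<open>G\<close>, \<open>pG\<close> fixes it and \<open>pV\<close> kills it; it contributes
      only \<open>brG ?a ?b\<close> to the first component.\<close>
    have G_ab: "brG ?a ?b \<in> G"
      using G.bracket_bilinear memG by (simp add: bilinear_on_def linear_on_def)
    have cl: "brG ?a ?b \<in> E" "brE ?u ?b \<in> E" "brE ?v ?a \<in> E" "brE ?u ?v \<in> E"
      using closed mem G_ab GE by auto
    note E_diff = G.subspace_diff[OF subE]
    have "pG (brE x y) = brG ?a ?b + pG (brE ?u ?b) - pG (brE ?v ?a) + pG (brE ?u ?v)"
      unfolding eq brG[OF memG] using cl by (simp add: linp diffp E_add E_diff pG_G[OF G_ab])
    moreover have "pV (brE x y) = pV (brE ?u ?b) - pV (brE ?v ?a) + pV (brE ?u ?v)"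
      unfolding eq brG[OF memG] using cl by (simp add: linp diffp E_add E_diff pV_G[OF G_ab])
    ultimately show ?thesis
      by (simp add: \<phi>_eq unified_bracket_def \<Omega>_def)
  qed

  have cobracket: "?\<delta> (\<phi> x) = ?T \<phi> \<phi> (\<delta>E x)" if "x \<in> E" for x
  proof -
    let ?a = "pG x" and ?u = "pV x"
    have a: "?a \<in> G" and u: "?u \<in> V" using that pGE pVE by auto
    have prod: "\<delta>E y \<in> tensor_product s E s E" if "y \<in> E" for y
      using E.cobracket_linear that by (simp add: tensor_linear_on_def)
    have prodG: "\<delta>G ?a \<in> tensor_product s G s G"
      using G.cobracket_linear a by (simp add: tensor_linear_on_def)
    have incl: "linear_on s G s E (\<lambda>x. x)"
      using GE by (auto simp: linear_on_def)
    have \<phi>G: "linear_on s G ?s ?P \<phi>" by (rule linear_on_subset[OF \<phi> GE])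
    \<comment> \<open>On the \<open>G\<close>-part, the sub-bialgebra condition presents
      \<open>\<delta>E ?a\<close> as the image of \<open>\<delta>G ?a\<close> under the inclusion,
      and \<open>\<phi>\<close> restricted to \<open>G\<close> is \<open>iG\<close>. This produces
      the first summand of the unified cobracket.\<close>
    have "?T \<phi> \<phi> (\<delta>E ?a) = ?T \<phi> \<phi> (\<delta>G ?a)"
      by (simp add: \<delta>G[OF a] tensor_map_comp[OF incl incl \<phi> \<phi> prodG])
    also have "\<dots> = ?T iG iG (\<delta>G ?a)"
      by (rule tensor_map_cong[OF \<phi>G \<phi>G iG iG _ _ prodG]) (simp_all add: \<phi>_eq iG_def pG_G pV_G)
    finally have Ta: "?T \<phi> \<phi> (\<delta>E ?a) = ?T iG iG (\<delta>G ?a)" .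
    have uE: "?u \<in> E" and aE: "?a \<in> E" using u VE a GE by auto
    have "\<delta>E x = \<delta>E (?a + ?u)" by (simp add: pV_def)
    also have "\<dots> = \<delta>E ?a + \<delta>E ?u"
      using E.cobracket_linear aE uE unfolding tensor_linear_on_def by blast
    finally have "?T \<phi> \<phi> (\<delta>E x) = ?T iG iG (\<delta>G ?a) + ?T \<phi> \<phi> (\<delta>E ?u)"
      by (simp add: tensor_map_add[OF \<phi> \<phi> prod[OF aE] prod[OF uE]] Ta)
    \<comment> \<open>On the \<open>V\<close>-part, the four components of the skew tensor
      \<open>\<delta>E ?u\<close> are exactly the remaining four summands of the unified
      cobracket.\<close>
    also have "?T \<phi> \<phi> (\<delta>E ?u) =
        ?T iG iV (DeltaE \<Omega> ?u) + uminus ` ?T iV iG (tensor_swap s G s V (DeltaE \<Omega> ?u))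
        + ?T iG iG (DeltaV \<Omega> ?u) + ?T iV iV (deltaV \<Omega> ?u)"
      unfolding \<phi>_def[abs_def] \<Omega>_def extending_datum.simps
      by (rule skew_tensor_decompose[OF vsP subP pG pV iG iV prod[OF uE] E.cobracket_skew[OF uE]])
    finally show ?thesis
      unfolding \<phi>_eq[of x]
      by (simp add: unified_cobracket_def Let_def iG_def[abs_def] iV_def[abs_def] add.assoc)
  qed

  have surj: "\<phi> ` E = ?P"
  proof
    show "\<phi> ` E \<subseteq> ?P" using \<phi> by (auto simp: linear_on_def)
    show "?P \<subseteq> \<phi> ` E"
    proof clarify
      fix a v assume av: "a \<in> G" "v \<in> V"
      then have "a \<in> E" "v \<in> E" using GE VE by auto
      then have "\<phi> (a + v) = (a, v)" "a + v \<in> E"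
        using av pG pV G.subspace_add[OF subE]
        by (simp_all add: \<phi>_eq linear_on_def pG_G pG_V pV_G pV_V)
      then show "(a, v) \<in> \<phi> ` E" by (metis image_eqI)
    qed
  qed
  have inj: "inj_on \<phi> E"
    by (rule inj_on_inverseI[where g = "\<lambda>(a, v). a + v"]) (simp add: \<phi>_eq pV_def)
  have "lie_bialgebra ?s ?P ?br ?\<delta>"
    by (rule lie_bialgebra_transport[OF assms(8) vsP subP \<phi> surj bracket cobracket])
  moreover have "lie_bialgebra_hom s E brE \<delta>E ?s ?P ?br ?\<delta> \<phi>"
    using \<phi> by (simp add: lie_bialgebra_hom_def bracket cobracket)
  ultimately show ?thesis
    using datum surj inj
    unfolding lie_bialgebraic_extending_structure_def lie_bialgebra_isomorphic_def bij_betw_def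
    by blast
qed

end
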